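(* Let $p\in[0,1)$ and $q=2p-1\in[-1,1)$. There exists a zero-mean martingale $(\Xi_n)_{n\ge0}$ adapted to $(\mathcal F_n)_{n\ge0}$, with bounded increments and with predictable quadratic variation $\langle\Xi\rangle_n=\sum_{k=1}^n\mathbb E[(\Xi_k-\Xi_{k-1})^2\mid\mathcal F_{k-1}]$ satisfying $\langle\Xi\rangle_n/n\to1$ almost surely, such that for all $n\ge 0$ $$\Delta^{(s)}_n=\Xi_n+q\sum_{k=1}^{n-1}(-1)^k\frac{W_k}{k}.$$ Moreover the predictable process $Z_n:=\Delta^{(s)}_n-\Xi_n$ converges almost surely and in $L^2$ to the zero-mean random variable $Z_\infty:=q\sum_{k=1}^\infty(-1)^k\frac{W_k}{k}$, whose second moment is $$\mathbb E[Z_\infty^2]=\begin{cases}\dfrac{q^2}{2q-1}\displaystyle\int_0^1\frac{u^{-2q+1}-1}{1-u}\cdot\frac{(1-\frac u2)^{q-1}-1}{u}\,du & q\neq\tfrac12,\\[8pt] \dfrac14\displaystyle\int_0^1\frac{-\ln u}{1-u}\cdot\frac{(1-\frac u2)^{-1/2}-1}{u}\,du & q=\tfrac12.\end{cases}$$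
   Context: Let $D_\infty=\langle a,b\mid a^2=e,\ b^2=e\rangle$ be the infinite dihedral group (its Cayley graph with respect to $\{a,b\}$ is the bi-infinite path). Fix a memory parameter $p\in[0,1]$ and set $q=2p-1$. The elephant random walk (ERW) on $D_\infty$ has steps $g_1,g_2,\dots\in\{a,b\}$ defined as follows: $g_1$ is uniform on $\{a,b\}$; with $\mathcal F_n=\sigma(g_1,\dots,g_n)$ ($\mathcal F_0$ trivial), given $\mathcal F_n$ ($n\ge1$) pick $I_{n+1}$ uniform on $\{1,\dots,n\}$ and set $g_{n+1}=g_{I_{n+1}}$ with probability $p$ and $g_{n+1}=$ the other generator (i.e. $b$ if $g_{I_{n+1}}=a$, $a$ if $g_{I_{n+1}}=b$) with probability $1-p$. Equivalently, if $A_n,B_n$ denote the numbers of $a$-steps and $b$-steps among $g_1,\dots,g_n$, then $\mathbb P(g_{n+1}=a\mid\mathcal F_n)=\frac{pA_n+(1-p)B_n}{n}$. The position is $w_0=e$ and $w_n$ = the reduced word of $g_ng_{n-1}\cdots g_1$ (reduced using $a^2=b^2=e$); $\Delta_n$ is the length of $w_n$. The signed location is $\Delta^{(s)}_n=\Delta_n$ if $w_n=e$ or the rightmost letter of the reduced word $w_n$ is $a$, and $\Delta^{(s)}_n=-\Delta_n$ if its rightmost letter is $b$ (so $a,ba,aba,\dots$ sit at $1,2,3,\dots$ and $b,ab,bab,\dots$ at $-1,-2,-3,\dots$). Finally $W_0=0$ and $W_n=A_n-B_n$ (this is the classical elephant random walk on $\mathbb Z$). *)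

theory Defs
  imports "HOL-Probability.Probability"
begin

text \<open>Generators of D_infinity are encoded as booleans: True = a, False = b.
  Steps are g 1, g 2, ... (g 0 is unused).\<close>

text \<open>Left multiplication of a reduced word (list, leftmost letter first) by a generator,
  reducing with a^2 = b^2 = e.\<close>
fun mul_gen :: "bool \<Rightarrow> bool list \<Rightarrow> bool list" where
  "mul_gen x [] = [x]"
| "mul_gen x (y # ys) = (if x = y then ys else x # y # ys)"

primrec erw_word :: "(nat \<Rightarrow> 'a \<Rightarrow> bool) \<Rightarrow> nat \<Rightarrow> 'a \<Rightarrow> bool list" where
  "erw_word g 0 \<omega> = []"
| "erw_word g (Suc n) \<omega> = mul_gen (g (Suc n) \<omega>) (erw_word g n \<omega>)"

definition signed_loc :: "bool list \<Rightarrow> real" where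
  "signed_loc w = (if w = [] \<or> last w then real (length w) else - real (length w))"

definition Delta_s :: "(nat \<Rightarrow> 'a \<Rightarrow> bool) \<Rightarrow> nat \<Rightarrow> 'a \<Rightarrow> real" where
  "Delta_s g n \<omega> = signed_loc (erw_word g n \<omega>)"

definition A_cnt :: "(nat \<Rightarrow> 'a \<Rightarrow> bool) \<Rightarrow> nat \<Rightarrow> 'a \<Rightarrow> real" where
  "A_cnt g n \<omega> = real (card {k \<in> {1..n}. g k \<omega>})"

definition B_cnt :: "(nat \<Rightarrow> 'a \<Rightarrow> bool) \<Rightarrow> nat \<Rightarrow> 'a \<Rightarrow> real" where
  "B_cnt g n \<omega> = real (card {k \<in> {1..n}. \<not> g k \<omega>})"

definition W_erw :: "(nat \<Rightarrow> 'a \<Rightarrow> bool) \<Rightarrow> nat \<Rightarrow> 'a \<Rightarrow> real" where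
  "W_erw g n \<omega> = A_cnt g n \<omega> - B_cnt g n \<omega>"

definition erw_filt :: "'a measure \<Rightarrow> (nat \<Rightarrow> 'a \<Rightarrow> bool) \<Rightarrow> nat \<Rightarrow> 'a measure" where
  "erw_filt M g n = sigma (space M) {{\<omega> \<in> space M. g k \<omega>} | k. k \<in> {1..n}}"

definition is_martingale :: "'a measure \<Rightarrow> (nat \<Rightarrow> 'a measure) \<Rightarrow> (nat \<Rightarrow> 'a \<Rightarrow> real) \<Rightarrow> bool" where
  "is_martingale M F X \<longleftrightarrow>
     (\<forall>n. integrable M (X n) \<and> X n \<in> borel_measurable (F n) \<and>
          (\<forall>A \<in> sets (F n). (LINT \<omega>:A|M. X (Suc n) \<omega>) = (LINT \<omega>:A|M. X n \<omega>)))"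

definition pred_qv :: "'a measure \<Rightarrow> (nat \<Rightarrow> 'a measure) \<Rightarrow> (nat \<Rightarrow> 'a \<Rightarrow> real) \<Rightarrow> nat \<Rightarrow> 'a \<Rightarrow> real" where
  "pred_qv M F X n \<omega> =
     (\<Sum>k\<in>{1..n}. real_cond_exp M (F (k - 1)) (\<lambda>x. (X k x - X (k - 1) x)\<^sup>2) \<omega>)"

end

theory Submission
  imports Defs "HOL-Real_Asymp.Real_Asymp"
begin

text \<open>
  Write \<open>\<epsilon>\<^sub>k = \<plusminus>1\<close> for the sign of step \<open>k\<close>, \<open>c\<^sub>n = W\<^sub>n / n\<close> and \<open>d\<^sub>n = \<epsilon>\<^bsub>n+1\<^esub> - q c\<^sub>n\<close>, which is a martingale difference. The parity
  of the location equals that of the time, so \<open>\<Delta>\<^sup>(\<^sup>s\<^sup>)\<^sub>n = \<Sum>\<^bsub>k<n\<^esub> (-1)\<^sup>k \<epsilon>\<^bsub>k+1\<^esub>\<close>, and \<open>\<Xi>\<^sub>n = \<Sum>\<^bsub>k<n\<^esub> (-1)\<^sup>k d\<^sub>k\<close> is the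
  martingale part.

  Since \<open>c\<^bsub>n+1\<^esub> = (n+q)/(n+1) c\<^sub>n + d\<^sub>n/(n+1)\<close>, the expectations of \<open>c\<^sub>n\<^sup>2/(n+1)\<close> are summable; as
  \<open>c\<^sub>n\<close> varies by at most \<open>2/(n+1)\<close> per step, \<open>c\<^sub>n \<rightarrow> 0\<close> almost surely.

  If \<open>H\<^sub>n = 1 - (n+q)/(n+1) H\<^bsub>n+1\<^esub>\<close>, then \<open>(\<Sum>\<^bsub>k<n\<^esub> (-1)\<^sup>k c\<^sub>k) + (-1)\<^sup>n H\<^sub>n c\<^sub>n\<close> is a martingale with increments
  \<open>(-1)\<^bsup>n+1\<^esup> H\<^bsub>n+1\<^esub> d\<^sub>n/(n+1)\<close>. Its variance increments are \<open>O(1/n\<^sup>2)\<close> and its increments \<open>O(1/n)\<close>, so it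
  converges almost surely (along fourth powers first) and in \<open>L\<^sup>2\<close>, with limit \<open>Z\<^sub>\<infinity>/q\<close> and second moment
  \<open>\<Sum> E[c\<^sub>k\<^sup>2] (2H\<^sub>k - 1)\<close>. The bounded solution has
  \<open>2H\<^sub>k - 1 = \<integral> k (1-u)\<^bsup>k-1\<^esup> ((1-u/2)\<^bsup>q-1\<^esup> - 1) du\<close> over \<open>[0,1]\<close>, and exchanging sum and integral leaves the
  generating function of \<open>k E[c\<^sub>k\<^sup>2]\<close>, which is elementary.
\<close>

section \<open>Limits of slowly varying real sequences and of averages\<close>

lemma summable_inverse_Suc_squares: "summable (\<lambda>n. 1 / (real n + 1)\<^sup>2)"
  using summable_Suc_iff[of "\<lambda>n. inverse ((real n)^2)"] inverse_power_summable[of 2, where 'a = real]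
  by (simp add: field_simps)

text \<open>The increments of \<open>x\<^sup>2\<close> are absolutely summable, so \<open>x\<close> has a limit, which the harmonic series forces to be 0.\<close>

lemma slowly_varying_tendsto_zero:
  fixes x :: "nat \<Rightarrow> real"
  assumes nonneg: "\<And>n. 0 \<le> x n"
    and slow: "\<And>n. \<bar>x (Suc n) - x n\<bar> \<le> K / (real n + 1)"
    and summ: "summable (\<lambda>n. x n / (real n + 1))"
  shows "x \<longlonglongrightarrow> 0"
proof -
  have "0 \<le> K"
    using order_trans[OF abs_ge_zero slow[of 0]] by simp
  have bound: "norm ((x (Suc n))\<^sup>2 - (x n)\<^sup>2) \<le> 2 * K * (x n / (real n + 1)) + K\<^sup>2 * (1 / (real n + 1)\<^sup>2)" for n
  proof -
    have "norm ((x (Suc n))\<^sup>2 - (x n)\<^sup>2) = \<bar>x (Suc n) - x n\<bar> * (x (Suc n) + x n)"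
      using nonneg[of n] nonneg[of "Suc n"] by (simp add: power2_eq_square square_diff_square_factored abs_mult)
    also have "\<dots> \<le> K / (real n + 1) * (2 * x n + K / (real n + 1))"
      using slow[of n] nonneg[of n] nonneg[of "Suc n"] \<open>0 \<le> K\<close> by (intro mult_mono) auto
    also have "\<dots> = 2 * K * (x n / (real n + 1)) + K\<^sup>2 * (1 / (real n + 1)\<^sup>2)"
      by (simp add: power2_eq_square algebra_simps)
    finally show ?thesis .
  qed
  have "summable (\<lambda>n. (x (Suc n))\<^sup>2 - (x n)\<^sup>2)"
    by (rule summable_comparison_test'[OF _ bound]) (intro summable_add summable_mult summ summable_inverse_Suc_squares)
  then have "convergent (\<lambda>N. (x N)\<^sup>2 - (x 0)\<^sup>2)"
    unfolding summable_iff_convergent by (simp add: sum_lessThan_telescope[of "\<lambda>n. (x n)\<^sup>2"])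
  then have "convergent (\<lambda>N. (x N)\<^sup>2 - (x 0)\<^sup>2 + (x 0)\<^sup>2)"
    by (intro convergent_add convergent_const)
  then obtain L where "(\<lambda>N. (x N)\<^sup>2) \<longlonglongrightarrow> L"
    by (auto simp: convergent_def)
  then have "(\<lambda>N. sqrt ((x N)\<^sup>2)) \<longlonglongrightarrow> sqrt L"
    by (rule tendsto_real_sqrt)
  then have lim: "x \<longlonglongrightarrow> sqrt L"
    using nonneg by simp
  have "sqrt L = 0"
  proof (rule ccontr)
    assume "sqrt L \<noteq> 0"
    moreover have "0 \<le> sqrt L"
      using lim nonneg by (intro LIMSEQ_le_const[OF lim]) auto
    ultimately have pos: "0 < sqrt L" by simp
    then have "\<forall>\<^sub>F n in sequentially. sqrt L / 2 < x n"
      by (intro order_tendstoD(1)[OF lim]) simp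
    then have "\<forall>\<^sub>F n in sequentially. norm (sqrt L / 2 * inverse (real (Suc n))) \<le> x n / (real n + 1)"
    proof eventually_elim
      case (elim n)
      then have "sqrt L / 2 / (real n + 1) \<le> x n / (real n + 1)"
        by (intro divide_right_mono) auto
      moreover have "norm (sqrt L / 2 * inverse (real (Suc n))) = sqrt L / 2 / (real n + 1)"
        using pos by (simp add: abs_mult field_simps)
      ultimately show ?case by (simp only:)
    qed
    then have "summable (\<lambda>n. sqrt L / 2 * inverse (real (Suc n)))"
      by (rule summable_comparison_test_ev[OF _ summ])
    then have "summable (\<lambda>n. inverse (real (Suc n)))"
      using pos by (subst (asm) summable_cmult_iff) auto
    then have "summable (\<lambda>n. inverse (real n))"
      by (subst (asm) summable_Suc_iff)
    then show False
      using not_summable_harmonic[where 'a = real] by simp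
  qed
  with lim show ?thesis by simp
qed

text \<open>Cesaro averaging: the finitely many large terms contribute at most \<open>C / n\<close>,
  the rest at most \<open>e / 2\<close> on average.\<close>

lemma tendsto_average_zero:
  fixes f :: "nat \<Rightarrow> real"
  assumes "f \<longlonglongrightarrow> 0"
  shows "(\<lambda>n. (\<Sum>k<n. f k) / real n) \<longlonglongrightarrow> 0"
proof (rule LIMSEQ_I)
  fix e :: real assume "0 < e"
  then obtain N where N: "\<And>k. k \<ge> N \<Longrightarrow> \<bar>f k\<bar> < e / 2"
    using LIMSEQ_D[OF assms, of "e / 2"] by auto
  define C where "C = (\<Sum>k<N. \<bar>f k\<bar>)"
  have bound: "\<bar>\<Sum>k<n. f k\<bar> \<le> C + real n * (e / 2)" for n
  proof -
    have "\<bar>f k\<bar> \<le> (if k < N then \<bar>f k\<bar> else 0) + e / 2" for k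
      using N[of k] \<open>0 < e\<close> by (cases "k < N") auto
    then have "(\<Sum>k<n. \<bar>f k\<bar>) \<le> (\<Sum>k<n. (if k < N then \<bar>f k\<bar> else 0) + e / 2)"
      by (intro sum_mono)
    also have "\<dots> = (\<Sum>k\<in>{..<n} \<inter> {..<N}. \<bar>f k\<bar>) + real n * (e / 2)"
      by (simp add: sum.distrib sum.inter_restrict lessThan_def)
    also have "(\<Sum>k\<in>{..<n} \<inter> {..<N}. \<bar>f k\<bar>) \<le> C"
      unfolding C_def by (intro sum_mono2) auto
    finally show ?thesis
      using sum_abs[of f "{..<n}"] by linarith
  qed
  have "(\<lambda>n. C / real n) \<longlonglongrightarrow> 0"
    by real_asymp
  from LIMSEQ_D[OF this, of "e / 2"] \<open>0 < e\<close>
  obtain N' where N': "\<forall>n\<ge>N'. norm (C / real n - 0) < e / 2"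
    by auto
  show "\<exists>no. \<forall>n\<ge>no. norm ((\<Sum>k<n. f k) / real n - 0) < e"
  proof (intro exI[of _ "Suc N'"] allI impI)
    fix n assume "Suc N' \<le> n"
    then have "0 < real n" "N' \<le> n" by auto
    have "\<bar>(\<Sum>k<n. f k) / real n\<bar> \<le> (C + real n * (e / 2)) / real n"
      using bound[of n] \<open>0 < real n\<close> by (simp add: divide_right_mono)
    also have "\<dots> = C / real n + e / 2"
      using \<open>0 < real n\<close> by (simp add: field_simps)
    also have "\<dots> < e"
      using N'[rule_format, OF \<open>N' \<le> n\<close>] unfolding real_norm_def diff_0_right by linarith
    finally show "norm ((\<Sum>k<n. f k) / real n - 0) < e"
      by simp
  qed
qed

text \<open>Between \<open>j ^ 4\<close> and \<open>(j + 1) ^ 4\<close> there are only O(j^3) steps,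
  each of size at most \<open>K / (j ^ 4 + 1)\<close>, so the oscillation inside a block vanishes.
  Fourth powers are sparse enough that a variance bound \<open>1 / m\<close> at
  \<open>m = j ^ 4\<close> stays summable even after weighting by \<open>j ^ 2\<close>.\<close>

lemma slowly_varying_tendsto_of_fourth_powers:
  fixes X :: "nat \<Rightarrow> real"
  assumes slow: "\<And>n. \<bar>X (Suc n) - X n\<bar> \<le> K / (real n + 1)"
    and lim: "(\<lambda>j. X (j ^ 4)) \<longlonglongrightarrow> l"
  shows "X \<longlonglongrightarrow> l"
proof (rule LIMSEQ_I)
  fix e :: real assume "0 < e"
  have "0 \<le> K"
    using order_trans[OF abs_ge_zero slow[of 0]] by simp
  have gap: "\<bar>X (m + i) - X m\<bar> \<le> real i * (K / (real m + 1))" for m i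
  proof (induction i)
    case (Suc i)
    have "K / (real (m + i) + 1) \<le> K / (real m + 1)"
      using \<open>0 \<le> K\<close> by (intro divide_left_mono) auto
    then show ?case
      using Suc slow[of "m + i"] by (simp add: ring_distribs add_divide_distrib)
  qed simp
  have "(\<lambda>j. ((real j + 1) ^ 4 - real j ^ 4) * (K / (real j ^ 4 + 1))) \<longlonglongrightarrow> 0"
    by real_asymp
  then have "\<forall>\<^sub>F j in sequentially. ((real j + 1) ^ 4 - real j ^ 4) * (K / (real j ^ 4 + 1)) < e / 2"
    using \<open>0 < e\<close> by (intro order_tendstoD(2)) auto
  moreover have "\<forall>\<^sub>F j in sequentially. dist (X (j ^ 4)) l < e / 2"
    using lim \<open>0 < e\<close> by (intro tendstoD) auto
  ultimately have "\<forall>\<^sub>F j in sequentially. ((real j + 1) ^ 4 - real j ^ 4) * (K / (real j ^ 4 + 1)) < e / 2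
      \<and> dist (X (j ^ 4)) l < e / 2"
    by (rule eventually_conj)
  then obtain J where J: "\<And>j. j \<ge> J \<Longrightarrow> ((real j + 1) ^ 4 - real j ^ 4) * (K / (real j ^ 4 + 1)) < e / 2"
      "\<And>j. j \<ge> J \<Longrightarrow> dist (X (j ^ 4)) l < e / 2"
    unfolding eventually_sequentially by blast
  show "\<exists>no. \<forall>n\<ge>no. norm (X n - l) < e"
  proof (intro exI[of _ "J ^ 4"] allI impI)
    fix n assume n: "J ^ 4 \<le> n"
    \<comment> \<open>The integer fourth root of \<open>n\<close>, that is,
      \<open>j ^ 4 \<le> n < (j + 1) ^ 4\<close>.\<close>
    define j where "j = (LEAST j. n < Suc j ^ 4)"
    have "n < Suc n ^ 4"
      using self_le_power[of "Suc n" 4] by linarith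
    then have j: "n < Suc j ^ 4"
      unfolding j_def by (rule LeastI)
    have j': "j ^ 4 \<le> n"
    proof (cases j)
      case (Suc i)
      then have "\<not> n < Suc i ^ 4"
        using not_less_Least[of i "\<lambda>j. n < Suc j ^ 4"] by (simp add: j_def)
      then show ?thesis using Suc by simp
    qed simp
    have "J ^ 4 < Suc j ^ 4"
      using n j by linarith
    then have "J \<le> j"
      using power_less_imp_less_base by fastforce
    have "\<bar>X n - X (j ^ 4)\<bar> \<le> real (n - j ^ 4) * (K / (real (j ^ 4) + 1))"
      using gap[of "j ^ 4" "n - j ^ 4"] j' by simp
    also have "\<dots> \<le> ((real j + 1) ^ 4 - real j ^ 4) * (K / (real j ^ 4 + 1))"
    proof -
      have "real n \<le> real (Suc j ^ 4)" using j by (simp only: of_nat_le_iff)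
      then have "real (n - j ^ 4) \<le> (real j + 1) ^ 4 - real j ^ 4"
        using j' by (simp add: of_nat_diff add.commute)
      then show ?thesis
        using \<open>0 \<le> K\<close> by (simp only: of_nat_power) (intro mult_right_mono, auto)
    qed
    also have "\<dots> < e / 2" using J(1) \<open>J \<le> j\<close> by simp
    finally show "norm (X n - l) < e"
      using J(2)[OF \<open>J \<le> j\<close>] unfolding dist_real_def real_norm_def by linarith
  qed
qed

section \<open>The integral behind the bounded solution of the recurrence\<close>

text \<open>
  With \<open>F = \<^sub>2F\<^sub>1(1, k + q; k + 1; - 1)\<close> this is \<open>2F - 1\<close>, by Pfaff's transformation and Euler's
  integral; only the recurrence below is needed.
\<close>

definition hyp_excess :: "real \<Rightarrow> nat \<Rightarrow> real" where
  "hyp_excess q k = (LINT u:{0..1}|lborel. real k * (1 - u) ^ (k - 1) * ((1 - u / 2) powr (q - 1) - 1))"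

lemma hyp_excess_integrable:
  "set_integrable lborel {0..1} (\<lambda>u. real k * (1 - u) ^ m * ((1 - u / 2) powr (q - 1) - 1))"
  by (rule borel_integrable_atLeastAtMost') (auto intro!: continuous_intros)

lemma hyp_excess_0 [simp]: "hyp_excess q 0 = 0"
  by (simp add: hyp_excess_def set_lebesgue_integral_def)

lemma hyp_excess_nonneg:
  assumes "q \<le> 1"
  shows "0 \<le> hyp_excess q k"
  unfolding hyp_excess_def set_lebesgue_integral_def
proof (rule Bochner_Integration.integral_nonneg)
  fix u :: real
  have "1 \<le> (1 - u / 2) powr (q - 1)" if "0 \<le> u" "u \<le> 1"
    using powr_mono2'[of "q - 1" "1 - u / 2" 1] assms that by simp
  then show "0 \<le> indicator {0..1} u *\<^sub>R (real k * (1 - u) ^ (k - 1) * ((1 - u / 2) powr (q - 1) - 1))"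
    by (auto simp: indicator_def)
qed

text \<open>In terms of \<open>(1 + hyp_excess q k) / 2\<close> this becomes the recurrence for
  \<open>H\<close>. It follows from the fundamental theorem of calculus; \<open>k \<ge> 1\<close> is
  what kills the boundary term at \<open>u = 1\<close>, while \<open>G 0 = 0\<close> kills the one
  at \<open>u = 0\<close>.\<close>

lemma hyp_excess_recurrence:
  assumes "k \<ge> 1"
  shows "(real k + 1) * hyp_excess q k + (real k + q) * hyp_excess q (Suc k) = 1 - q"
proof -
  define G where "G u = (1 - u / 2) powr (q - 1) - 1" for u :: real
  \<comment> \<open>the integrand is the derivative of \<open>(1 - u)\<^sup>k (2 - u) G u\<close>, which vanishes at both endpoints\<close>
  have "(\<integral>u. ((1 - q) * (1 - u) ^ k - (real k * (1 - u) ^ (k - 1) + (real k + q) * (1 - u) ^ k) * G u)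
          * indicator {0..1} u \<partial>lborel) = (1 - 1) ^ k * (2 - 1) * G 1 - (1 - 0) ^ k * (2 - 0) * G 0"
  proof (rule integral_FTC_Icc_real)
    fix u :: real assume u: "0 \<le> u" "u \<le> 1"
    \<comment> \<open>The factor \<open>2 - u = 2 * (1 - u / 2)\<close> raises the exponent
      \<open>q - 2\<close> in the derivative of \<open>G\<close> back to \<open>q - 1\<close>, so
      that the derivative of the product is again affine in \<open>G u\<close>.\<close>
    have pw: "(1 - u / 2) powr (q - 1) = (1 - u / 2) * (1 - u / 2) powr (q - 2)"
      using u powr_mult_base[of "1 - u / 2" "q - 2"] by simp
    have k: "(1 - u) ^ k = (1 - u) * (1 - u) ^ (k - 1)"
      using assms by (simp add: power_eq_if)
    have "((\<lambda>u. (1 - u / 2) powr (q - 1)) has_real_derivative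
        (q - 1) * (1 - u / 2) powr (q - 1 - of_nat 1) * (- (1 / 2))) (at u)"
      using u by (intro DERIV_fun_powr) (auto intro!: derivative_eq_intros)
    then have dG: "(G has_real_derivative (1 - q) / 2 * (1 - u / 2) powr (q - 2)) (at u)"
      unfolding G_def by (auto intro!: DERIV_cong[OF DERIV_diff] DERIV_const simp: algebra_simps)
    have "((\<lambda>u. (1 - u) ^ k * (2 - u)) has_real_derivative
        - (real k * (1 - u) ^ (k - 1)) * (2 - u) - (1 - u) ^ k) (at u)"
      by (auto intro!: derivative_eq_intros)
    from DERIV_mult[OF this dG] have "((\<lambda>u. (1 - u) ^ k * (2 - u) * G u) has_real_derivative
        (- (real k * (1 - u) ^ (k - 1)) * (2 - u) - (1 - u) ^ k) * G u
          + (1 - u) ^ k * (2 - u) * ((1 - q) / 2 * (1 - u / 2) powr (q - 2))) (at u)"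
      by (rule DERIV_cong) (simp add: algebra_simps)
    also have "(- (real k * (1 - u) ^ (k - 1)) * (2 - u) - (1 - u) ^ k) * G u
          + (1 - u) ^ k * (2 - u) * ((1 - q) / 2 * (1 - u / 2) powr (q - 2))
        = (1 - q) * (1 - u) ^ k - (real k * (1 - u) ^ (k - 1) + (real k + q) * (1 - u) ^ k) * G u"
      unfolding G_def pw k by (simp add: algebra_simps add_divide_distrib diff_divide_distrib)
    finally show "((\<lambda>u. (1 - u) ^ k * (2 - u) * G u) has_real_derivative
      (1 - q) * (1 - u) ^ k - (real k * (1 - u) ^ (k - 1) + (real k + q) * (1 - u) ^ k) * G u) (at u)" .
    show "isCont (\<lambda>u. (1 - q) * (1 - u) ^ k - (real k * (1 - u) ^ (k - 1) + (real k + q) * (1 - u) ^ k) * G u) u"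
      unfolding G_def using u by (intro continuous_intros) auto
  qed simp
  then have zero: "(LINT u:{0..1}|lborel. (1 - q) * (1 - u) ^ k - (real k * (1 - u) ^ (k - 1) * G u + (real k + q) * (1 - u) ^ k * G u)) = 0"
    using assms by (simp add: set_lebesgue_integral_def G_def power_0_left mult.commute ring_distribs)
  have cint: "set_integrable lborel {0..1} f" if "continuous_on {0..1} f" for f :: "real \<Rightarrow> real"
    by (rule borel_integrable_atLeastAtMost') fact
  have mono: "(LINT u:{0..1}|lborel. (1 - u) ^ k) = 1 / (real k + 1)"
  proof -
    have "(\<integral>u. (1 - u) ^ k * indicator {0..1} u \<partial>lborel)
        = - ((1 - 1) ^ Suc k / (real k + 1)) - (- ((1 - 0) ^ Suc k / (real k + 1)))"
    proof (rule integral_FTC_Icc_real)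
      fix u :: real
      have "((\<lambda>u. 1 - u) has_real_derivative - 1) (at u)"
        by (auto intro!: derivative_eq_intros)
      from DERIV_minus[OF DERIV_cdivide[OF DERIV_power[OF this, of "Suc k"], of "real k + 1"]]
      show "((\<lambda>u. - ((1 - u) ^ Suc k / (real k + 1))) has_real_derivative (1 - u) ^ k) (at u)"
        by (rule DERIV_cong) (simp add: field_simps)
    qed (auto intro!: continuous_intros)
    then show ?thesis by (simp add: set_lebesgue_integral_def mult.commute)
  qed
  have 1: "(LINT u:{0..1}|lborel. real k * (1 - u) ^ (k - 1) * G u) = hyp_excess q k"
    by (simp add: hyp_excess_def G_def)
  have 2: "(LINT u:{0..1}|lborel. (real k + q) * (1 - u) ^ k * G u) = (real k + q) * hyp_excess q (Suc k) / (real k + 1)"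
  proof -
    have "hyp_excess q (Suc k) = (LINT u:{0..1}|lborel. (real k + 1) * ((1 - u) ^ k * G u))"
      by (simp add: hyp_excess_def G_def mult.assoc add.commute)
    then show ?thesis by (simp add: mult.assoc)
  qed
  have "(LINT u:{0..1}|lborel. (1 - q) * (1 - u) ^ k - (real k * (1 - u) ^ (k - 1) * G u + (real k + q) * (1 - u) ^ k * G u))
    = (LINT u:{0..1}|lborel. (1 - q) * (1 - u) ^ k)
      - ((LINT u:{0..1}|lborel. real k * (1 - u) ^ (k - 1) * G u) + (LINT u:{0..1}|lborel. (real k + q) * (1 - u) ^ k * G u))"
    by (subst set_integral_diff; (subst set_integral_add)?)
       (auto intro!: cint set_integral_add continuous_intros simp: G_def)
  also have "\<dots> = (1 - q) * (1 / (real k + 1)) - (hyp_excess q k + (real k + q) * hyp_excess q (Suc k) / (real k + 1))"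
    by (simp only: set_integral_mult_right mono 1 2)
  finally have "(1 - q) * (1 / (real k + 1)) - (hyp_excess q k + (real k + q) * hyp_excess q (Suc k) / (real k + 1)) = 0"
    using zero by simp
  moreover have "(real k + 1) * (1 / (real k + 1)) = 1"
    by simp
  moreover have "(real k + q) * hyp_excess q (Suc k) / (real k + 1) = (real k + q) * hyp_excess q (Suc k) * (1 / (real k + 1))"
    by simp
  ultimately show ?thesis
    by algebra
qed

text \<open>Both terms on the left of the recurrence are nonnegative, because
  \<open>k + q \<ge> 0\<close> for \<open>k \<ge> 1\<close>; dropping the second one gives the
  bound.\<close>

lemma hyp_excess_le:
  assumes "k \<ge> 1" "-1 \<le> q" "q \<le> 1"
  shows "hyp_excess q k \<le> (1 - q) / (real k + 1)"
proof -
  have "0 \<le> (real k + q) * hyp_excess q (Suc k)"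
    using assms by (intro mult_nonneg_nonneg hyp_excess_nonneg) auto
  then have "(real k + 1) * hyp_excess q k \<le> 1 - q"
    using hyp_excess_recurrence[OF assms(1), of q] by linarith
  then show ?thesis by (simp add: field_simps)
qed

section \<open>The second moment of the walk and its generating function\<close>

text \<open>Here \<open>v n\<close> stands for the second moment of \<open>W_erw g n\<close>. The
  sequence \<open>- n / (2 * q - 1)\<close> is a particular solution, and
  \<open>n * pochhammer (2 * q) n / fact n\<close> solves the homogeneous recurrence. At
  \<open>n = 0\<close> both sides vanish, the left one because division by zero yields zero.\<close>

lemma second_moment_closed_form:
  fixes v :: "nat \<Rightarrow> real"
  assumes v1: "v 1 = 1" and rec: "\<And>n. n \<ge> 1 \<Longrightarrow> v (Suc n) = 1 + (1 + 2 * q / real n) * v n"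
    and "q \<noteq> 1 / 2"
  shows "v n / real n = (pochhammer (2 * q) n / fact n - 1) / (2 * q - 1)"
proof (cases "n = 0")
  case False
  then have "n \<ge> 1" by simp
  then have "v n = real n * ((pochhammer (2 * q) n / fact n - 1) / (2 * q - 1))"
  proof (induction n rule: dec_induct)
    case base
    show ?case using v1 \<open>q \<noteq> 1 / 2\<close> by simp
  next
    case (step n)
    define P :: real where "P = pochhammer (2 * q) n / fact n"
    have P': "pochhammer (2 * q) (Suc n) / fact (Suc n) = P * (2 * q + real n) / (real n + 1)"
      by (simp add: P_def pochhammer_Suc field_simps)
    have "v (Suc n) = 1 + (1 + 2 * q / real n) * (real n * ((P - 1) / (2 * q - 1)))"
      using rec[OF step.hyps(1)] step.IH by (simp add: P_def)
    also have "\<dots> = 1 + (real n + 2 * q) * ((P - 1) / (2 * q - 1))"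
    proof -
      have "(1 + 2 * q / real n) * real n = real n + 2 * q"
        using step.hyps(1) by (simp add: field_simps)
      then show ?thesis by (simp only: mult.assoc[symmetric])
    qed
    also have "\<dots> = real (Suc n) * ((P * (2 * q + real n) / (real n + 1) - 1) / (2 * q - 1))"
    proof -
      have "2 * q - 1 \<noteq> 0" using \<open>q \<noteq> 1 / 2\<close> by simp
      then show ?thesis by (simp add: divide_simps) (simp add: algebra_simps)
    qed
    finally show ?case by (simp only: P')
  qed
  then show ?thesis using False by simp
qed simp

text \<open>The resonant case \<open>2 * q = 1\<close>, where the linear particular solution breaks
  down: dividing by \<open>n + 1\<close> shows that \<open>v n / n\<close> grows by
  \<open>1 / (n + 1)\<close> in each step.\<close>

lemma second_moment_closed_form_half:
  fixes v :: "nat \<Rightarrow> real"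
  assumes v1: "v 1 = 1" and rec: "\<And>n. n \<ge> 1 \<Longrightarrow> v (Suc n) = 1 + (1 + 1 / real n) * v n"
  shows "v n / real n = harm n"
proof (cases "n = 0")
  case False
  then have "n \<ge> 1" by simp
  then have "v n = real n * harm n"
  proof (induction n rule: dec_induct)
    case base
    show ?case using v1 by (simp add: harm_def)
  next
    case (step n)
    have "(1 + 1 / real n) * real n = real n + 1"
      using step.hyps(1) by (simp add: field_simps)
    then have "v (Suc n) = 1 + (real n + 1) * harm n"
      using rec[OF step.hyps(1)] step.IH by (simp only: mult.assoc[symmetric])
    then show ?case
      by (simp add: harm_Suc field_simps)
  qed
  then show ?thesis using False by simp
qed (simp add: harm_def)

lemma pochhammer_series:
  fixes a x :: real
  assumes "\<bar>x\<bar> < 1"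
  shows "(\<lambda>n. pochhammer a n / fact n * x ^ n) sums (1 - x) powr (- a)"
proof -
  have "(\<lambda>n. (- a gchoose n) * (- x) ^ n) sums (1 + - x) powr (- a)"
    using assms by (intro gen_binomial_real) simp
  moreover have "(- a gchoose n) * (- x) ^ n = pochhammer a n / fact n * x ^ n" for n
  proof -
    have "(- 1 :: real) ^ n * (- x) ^ n = x ^ n"
      by (simp flip: power_mult_distrib)
    then show ?thesis by (simp add: gbinomial_pochhammer)
  qed
  ultimately show ?thesis by simp
qed

text \<open>Multiplication by \<open>1 - x\<close> takes differences of the harmonic numbers, which
  leaves the logarithm series.\<close>

lemma harm_series:
  fixes x :: real
  assumes "0 < x" "x < 1"
  shows "(\<lambda>n. harm n * x ^ n) sums (- ln (1 - x) / (1 - x))"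
proof -
  have le: "harm n \<le> real n" for n
  proof (induction n)
    case (Suc n)
    have "inverse (real (Suc n)) \<le> 1"
      by (simp add: field_simps)
    with Suc show ?case by (simp add: harm_Suc)
  qed (simp add: harm_def)
  \<comment> \<open>The derived geometric series has coefficients \<open>n + 1\<close>, which
    dominate the harmonic numbers.\<close>
  have "summable (\<lambda>n. diffs (\<lambda>_. 1) n * x ^ n)"
    using assms by (intro termdiff_converges[where K = 1]) (auto intro: summable_geometric)
  then have "summable (\<lambda>n. (real n + 1) * x ^ n)"
    by (simp add: diffs_def add.commute)
  then have summ: "summable (\<lambda>n. harm n * x ^ n)"
  proof (rule summable_comparison_test'[of _ 0])
    show "norm (harm n * x ^ n) \<le> (real n + 1) * x ^ n" for n
      using assms le[of n] harm_nonneg[of n, where 'a = real]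
      by (simp add: abs_mult mult_right_mono)
  qed
  define S where "S = (\<Sum>n. harm n * x ^ n)"
  have S: "(\<lambda>n. harm n * x ^ n) sums S"
    unfolding S_def using summ by (rule summable_sums)
  then have "(\<lambda>n. harm (Suc n) * x ^ Suc n) sums S"
    by (subst sums_Suc_iff) (simp add: harm_def)
  moreover have "(\<lambda>n. x * (harm n * x ^ n)) sums (x * S)"
    by (rule sums_mult[OF S])
  ultimately have "(\<lambda>n. harm (Suc n) * x ^ Suc n - x * (harm n * x ^ n)) sums (S - x * S)"
    by (rule sums_diff)
  then have "(\<lambda>n. x ^ Suc n / real (Suc n)) sums (S - x * S)"
    by (rule sums_cong[THEN iffD1, rotated]) (simp add: harm_Suc field_simps)
  moreover have "(\<lambda>n. x ^ Suc n / real (Suc n)) sums (- ln (1 - x))"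
  proof -
    have "(\<lambda>n. - (x ^ n / real n)) sums ln (1 - x)"
      using ln_series'[of "- x"] assms by simp
    then have "(\<lambda>n. x ^ n / real n) sums (- ln (1 - x))"
      using sums_minus by fastforce
    then show ?thesis
      by (subst sums_Suc_iff) simp
  qed
  ultimately have "S * (1 - x) = - ln (1 - x)"
    using sums_unique2 by (fastforce simp: algebra_simps)
  then have "S = - ln (1 - x) / (1 - x)"
    using assms by (subst nonzero_eq_divide_eq) auto
  then show ?thesis using S by simp
qed

section \<open>Signs of the steps and the signed location\<close>

definition erw_sign :: "(nat \<Rightarrow> 'a \<Rightarrow> bool) \<Rightarrow> nat \<Rightarrow> 'a \<Rightarrow> real" where
  "erw_sign g k \<omega> = (if g k \<omega> then 1 else -1)"

lemma A_cnt_plus_B_cnt: "A_cnt g n \<omega> + B_cnt g n \<omega> = real n"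
proof -
  have "card {k \<in> {1..n}. g k \<omega>} + card {k \<in> {1..n}. \<not> g k \<omega>}
      = card ({k \<in> {1..n}. g k \<omega>} \<union> {k \<in> {1..n}. \<not> g k \<omega>})"
    by (intro card_Un_disjoint[symmetric]) auto
  also have "{k \<in> {1..n}. g k \<omega>} \<union> {k \<in> {1..n}. \<not> g k \<omega>} = {1..n}"
    by auto
  finally show ?thesis
    by (simp add: A_cnt_def B_cnt_def flip: of_nat_add)
qed

lemma W_erw_eq_sum: "W_erw g n \<omega> = (\<Sum>k<n. erw_sign g (Suc k) \<omega>)"
proof (induction n)
  case (Suc n)
  have "{k \<in> {1..Suc n}. P k} = (if P (Suc n) then insert (Suc n) {k \<in> {1..n}. P k} else {k \<in> {1..n}. P k})" for P
    by (auto simp: le_Suc_eq)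
  with Suc show ?case
    by (simp add: W_erw_def A_cnt_def B_cnt_def erw_sign_def)
qed (simp add: W_erw_def A_cnt_def B_cnt_def)

text \<open>Steps act on the left end of the word, whereas the sign of the location is read off its
  right end; in an alternating word the parity of the length links the two.\<close>

lemma alternating_hd_eq_last:
  assumes "successively (\<noteq>) w" "w \<noteq> []"
  shows "hd w = (if odd (length w) then last w else \<not> last w)"
  using assms
proof (induction w)
  case (Cons x w)
  then show ?case by (cases w) auto
qed simp

lemma mul_gen_alternating:
  "successively (\<noteq>) w \<Longrightarrow> successively (\<noteq>) (mul_gen x w)"
  by (cases w) (auto simp: successively_Cons)

lemma even_length_mul_gen: "even (length (mul_gen x w)) = odd (length w)"
  by (cases w) auto

text \<open>The edges of the bi-infinite path carry the labels \<open>a\<close> and \<open>b\<close>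
  alternately, so \<open>a\<close> moves to the right from even sites and to the left from odd ones,
  and \<open>b\<close> does the opposite.\<close>

lemma signed_loc_mul_gen:
  assumes "successively (\<noteq>) w"
  shows "signed_loc (mul_gen x w) = signed_loc w + (-1) ^ length w * (if x then 1 else -1)"
proof (cases w)
  case (Cons y ys)
  have "y = (if even (length ys) then last (y # ys) else \<not> last (y # ys))"
    using alternating_hd_eq_last[OF assms] unfolding Cons by simp
  then show ?thesis
    using Cons by (cases "ys = []") (auto simp: signed_loc_def minus_one_power_iff split: if_splits)
qed (auto simp: signed_loc_def)

lemma Delta_s_eq_sum: "Delta_s g n \<omega> = (\<Sum>k<n. (-1) ^ k * erw_sign g (Suc k) \<omega>)"
proof -
  \<comment> \<open>The induction carries two further invariants: alternation, which
    \<open>signed_loc_mul_gen\<close> requires, and the parity of the length, which turns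
    \<open>(-1) ^ length\<close> into \<open>(-1) ^ n\<close>.\<close>
  have "successively (\<noteq>) (erw_word g n \<omega>) \<and> even (length (erw_word g n \<omega>)) = even n
      \<and> signed_loc (erw_word g n \<omega>) = (\<Sum>k<n. (-1) ^ k * erw_sign g (Suc k) \<omega>)"
  proof (induction n)
    case (Suc n)
    then have "(-1 :: real) ^ length (erw_word g n \<omega>) = (-1) ^ n"
      by (simp add: minus_one_power_iff)
    moreover have "successively (\<noteq>) (mul_gen (g (Suc n) \<omega>) (erw_word g n \<omega>))"
      using Suc by (blast intro: mul_gen_alternating)
    ultimately show ?case
      using Suc by (simp add: even_length_mul_gen signed_loc_mul_gen erw_sign_def)
  qed (simp add: signed_loc_def)
  then show ?thesis by (simp add: Delta_s_def)
qed

section \<open>Integration lemmas\<close>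

text \<open>By monotone convergence the sum has finite integral, hence it is finite almost
  everywhere. It replaces maximal inequalities in both almost sure convergence proofs below.\<close>

lemma AE_summable_of_summable_integral:
  fixes f :: "nat \<Rightarrow> 'a \<Rightarrow> real"
  assumes int: "\<And>i. integrable M (f i)" and nonneg: "\<And>i x. 0 \<le> f i x"
    and summ: "summable (\<lambda>i. \<integral>x. f i x \<partial>M)"
  shows "AE x in M. summable (\<lambda>i. f i x)"
proof -
  have [measurable]: "f i \<in> borel_measurable M" for i
    using int by auto
  have "(\<integral>\<^sup>+x. (\<Sum>i. ennreal (f i x)) \<partial>M) = (\<Sum>i. \<integral>\<^sup>+x. ennreal (f i x) \<partial>M)"
    by (intro nn_integral_suminf) auto
  also have "\<dots> = (\<Sum>i. ennreal (\<integral>x. f i x \<partial>M))"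
    using int nonneg by (simp add: nn_integral_eq_integral)
  also have "\<dots> = ennreal (\<Sum>i. \<integral>x. f i x \<partial>M)"
    using summ nonneg by (intro suminf_ennreal2) auto
  finally have "(\<integral>\<^sup>+x. (\<Sum>i. ennreal (f i x)) \<partial>M) \<noteq> \<infinity>"
    by simp
  then have "AE x in M. (\<Sum>i. ennreal (f i x)) \<noteq> \<infinity>"
    by (intro nn_integral_noteq_infinite) auto
  then show ?thesis
    by eventually_elim (use nonneg in \<open>auto intro!: summable_suminf_not_top\<close>)
qed

text \<open>Fatou's lemma in real-valued form. It carries a bound on \<open>Mart n - Mart m\<close>
  that is uniform in \<open>n\<close> over to the limit.\<close>

lemma fatou_integral_le:
  fixes X :: "nat \<Rightarrow> 'a \<Rightarrow> real"
  assumes int: "\<And>n. integrable M (X n)" and nonneg: "\<And>n x. 0 \<le> X n x"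
    and le: "\<And>n. n \<ge> N \<Longrightarrow> (\<integral>x. X n x \<partial>M) \<le> B"
    and [measurable]: "Y \<in> borel_measurable M"
    and lim: "AE x in M. (\<lambda>n. X n x) \<longlonglongrightarrow> Y x"
  shows "integrable M Y" "(\<integral>x. Y x \<partial>M) \<le> B"
proof -
  have [measurable]: "X n \<in> borel_measurable M" for n
    using int by auto
  have "0 \<le> (\<integral>x. X N x \<partial>M)"
    using nonneg by simp
  then have "0 \<le> B"
    using le[of N] by simp
  have Y: "AE x in M. 0 \<le> Y x"
    using lim by eventually_elim (use nonneg in \<open>auto intro: LIMSEQ_le_const\<close>)
  have "AE x in M. ennreal (Y x) = liminf (\<lambda>n. ennreal (X n x))"
    using lim
  proof eventually_elim
    case (elim x)
    then have "(\<lambda>n. ennreal (X n x)) \<longlonglongrightarrow> ennreal (Y x)"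
      by (rule tendsto_ennrealI)
    then show ?case
      by (simp add: lim_imp_Liminf)
  qed
  then have "(\<integral>\<^sup>+x. ennreal (Y x) \<partial>M) = (\<integral>\<^sup>+x. liminf (\<lambda>n. ennreal (X n x)) \<partial>M)"
    by (intro nn_integral_cong_AE)
  also have "\<dots> \<le> liminf (\<lambda>n. \<integral>\<^sup>+x. ennreal (X n x) \<partial>M)"
    by (intro nn_integral_liminf) auto
  also have "\<dots> \<le> ennreal B"
  proof (rule order_trans[OF Liminf_le_Limsup Limsup_bounded])
    show "\<forall>\<^sub>F n in sequentially. (\<integral>\<^sup>+x. ennreal (X n x) \<partial>M) \<le> ennreal B"
      using eventually_ge_at_top[of N]
    proof eventually_elim
      case (elim n)
      then show ?case
        using int nonneg le[OF elim] \<open>0 \<le> B\<close> by (simp add: nn_integral_eq_integral)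
    qed
  qed simp
  finally have nn: "(\<integral>\<^sup>+x. ennreal (Y x) \<partial>M) \<le> ennreal B" .
  then show int_Y: "integrable M Y"
    using Y by (intro integrableI_nonneg) (auto simp: less_top[symmetric] top_unique)
  show "(\<integral>x. Y x \<partial>M) \<le> B"
    using nn \<open>0 \<le> B\<close> by (simp add: nn_integral_eq_integral[OF int_Y Y])
qed

text \<open>Each term is at most \<open>1 / (k * (k + 1)) = 1 / k - 1 / (k + 1)\<close>, which
  telescopes.\<close>

lemma sum_inverse_squares_le:
  assumes "1 \<le> m" "m \<le> n"
  shows "(\<Sum>k=m..<n. 1 / (real k + 1)\<^sup>2) \<le> 1 / real m - 1 / real n"
  using assms(2,1)
proof (induction n rule: dec_induct)
  case (step n)
  have "1 / (real n + 1)\<^sup>2 \<le> 1 / real n - 1 / real (Suc n)"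
  proof -
    have "0 < real n" using step.hyps step.prems by simp
    then have "1 / real n - 1 / real (Suc n) = 1 / (real n * (real n + 1))"
      by (simp add: field_simps)
    moreover have "1 / (real n + 1)\<^sup>2 \<le> 1 / (real n * (real n + 1))"
      using \<open>0 < real n\<close> by (intro divide_left_mono) (auto simp: power2_eq_square)
    ultimately show ?thesis by simp
  qed
  with step show ?case by simp
qed simp

section \<open>The elephant random walk\<close>

text \<open>The assumption \<open>g_step\<close> is the conditional law of the next step, integrated
  over the events of the past. The strict bound \<open>p < 1\<close> gives \<open>q < 1\<close>,
  which drives the decay of \<open>mean_step\<close>.\<close>

locale elephant_walk = prob_space M for M :: "'a measure" +
  fixes g :: "nat \<Rightarrow> 'a \<Rightarrow> bool" and p q :: real
  assumes p_range: "0 \<le> p" "p < 1"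
    and q_def: "q = 2 * p - 1"
    and g_meas: "\<And>n. g n \<in> measurable M (count_space UNIV)"
    and g_first: "measure M {\<omega> \<in> space M. g 1 \<omega>} = 1 / 2"
    and g_step: "\<And>n A. n \<ge> 1 \<Longrightarrow> A \<in> sets (erw_filt M g n) \<Longrightarrow>
        measure M (A \<inter> {\<omega> \<in> space M. g (Suc n) \<omega>}) =
        (LINT \<omega>:A|M. (p * A_cnt g n \<omega> + (1 - p) * B_cnt g n \<omega>) / real n)"
begin

abbreviation "F \<equiv> erw_filt M g"
abbreviation "eps \<equiv> erw_sign g"

text \<open>Division by zero gives \<open>mean_step 0 = 0\<close>. Hence
  \<open>q * mean_step n\<close> is the conditional mean of the next sign at \<open>n = 0\<close>
  too, and sums over \<open>k\<close> may start at 0.\<close>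

definition mean_step :: "nat \<Rightarrow> 'a \<Rightarrow> real" where
  "mean_step n \<omega> = W_erw g n \<omega> / real n"

definition innov :: "nat \<Rightarrow> 'a \<Rightarrow> real" where
  "innov n \<omega> = eps (Suc n) \<omega> - q * mean_step n \<omega>"

lemma q_bounds: "-1 \<le> q" "q < 1" "\<bar>q\<bar> \<le> 1"
  using p_range q_def by auto

lemma g_events: "{\<omega> \<in> space M. g k \<omega>} \<in> sets M"
proof -
  have "g k -` {True} \<inter> space M \<in> sets M"
    using g_meas by (rule measurable_sets) simp
  also have "g k -` {True} \<inter> space M = {\<omega> \<in> space M. g k \<omega>}"
    by auto
  finally show ?thesis .
qed

lemma space_F: "space (F n) = space M"
  unfolding erw_filt_def by (rule space_measure_of) auto

lemma sets_F: "sets (F n) = sigma_sets (space M) {{\<omega> \<in> space M. g k \<omega>} | k. k \<in> {1..n}}"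
  unfolding erw_filt_def by (rule sets_measure_of) auto

lemma subalg_F: "subalgebra M (F n)"
  unfolding subalgebra_def space_F sets_F
  by (auto intro!: sets.sigma_sets_subset simp: g_events)

lemma F_sets_M: "A \<in> sets (F n) \<Longrightarrow> A \<in> sets M"
  using subalg_F unfolding subalgebra_def by blast

lemma F_borel_M: "f \<in> borel_measurable (F n) \<Longrightarrow> f \<in> borel_measurable M"
  by (rule measurable_from_subalg[OF subalg_F])

lemma erw_sign_measurable_F:
  assumes "1 \<le> k" "k \<le> n"
  shows "eps k \<in> borel_measurable (F n)"
proof -
  have [measurable]: "{\<omega> \<in> space (F n). g k \<omega>} \<in> sets (F n)"
    unfolding space_F sets_F using assms by (intro sigma_sets.Basic) auto
  show ?thesis
    unfolding erw_sign_def[abs_def] by measurable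
qed

lemma erw_sign_measurable [measurable]: "eps k \<in> borel_measurable M"
proof -
  have [measurable]: "{\<omega> \<in> space M. g k \<omega>} \<in> sets M"
    by (rule g_events)
  show ?thesis
    unfolding erw_sign_def[abs_def] by measurable
qed

lemma mean_step_0 [simp]: "mean_step 0 \<omega> = 0"
  by (simp add: mean_step_def)

lemma mean_step_measurable_F:
  assumes "k \<le> n"
  shows "mean_step k \<in> borel_measurable (F n)"
  unfolding mean_step_def[abs_def] W_erw_eq_sum
  using assms by (intro borel_measurable_divide borel_measurable_sum borel_measurable_const erw_sign_measurable_F) auto

lemma innov_measurable_F:
  assumes "k < n"
  shows "innov k \<in> borel_measurable (F n)"
  unfolding innov_def[abs_def] using assms
  by (intro borel_measurable_diff borel_measurable_times borel_measurable_const erw_sign_measurable_F mean_step_measurable_F) auto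

lemma mean_step_measurable [measurable]: "mean_step k \<in> borel_measurable M"
  by (rule F_borel_M[OF mean_step_measurable_F[OF order_refl]])

lemma innov_measurable [measurable]: "innov k \<in> borel_measurable M"
  unfolding innov_def[abs_def] by measurable

lemma abs_erw_sign [simp]: "\<bar>eps k \<omega>\<bar> = 1"
  by (simp add: erw_sign_def)

lemma abs_mean_step_le: "\<bar>mean_step n \<omega>\<bar> \<le> 1"
proof -
  have "\<bar>W_erw g n \<omega>\<bar> \<le> (\<Sum>k<n. \<bar>eps (Suc k) \<omega>\<bar>)"
    unfolding W_erw_eq_sum by (rule sum_abs)
  then show ?thesis by (cases "n = 0") (auto simp: mean_step_def field_simps)
qed

lemma abs_innov_le: "\<bar>innov n \<omega>\<bar> \<le> 2"
proof -
  have "\<bar>q * mean_step n \<omega>\<bar> \<le> 1"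
    unfolding abs_mult using q_bounds(3) abs_mean_step_le[of n \<omega>] by (intro mult_le_one) auto
  then show ?thesis
    unfolding innov_def using abs_erw_sign[of "Suc n" \<omega>] by linarith
qed

lemma integrable_bounded:
  fixes f :: "'a \<Rightarrow> real"
  assumes "f \<in> borel_measurable M" "\<And>\<omega>. \<bar>f \<omega>\<bar> \<le> B"
  shows "integrable M f"
  using assms by (intro integrable_const_bound[of _ B]) auto

lemma set_integral_erw_sign:
  assumes A: "A \<in> sets (F n)"
  shows "(LINT \<omega>:A|M. eps (Suc n) \<omega>) = (LINT \<omega>:A|M. q * mean_step n \<omega>)"
proof -
  have AM [measurable]: "A \<in> sets M" using A by (rule F_sets_M)
  have ev [measurable]: "{\<omega> \<in> space M. g (Suc n) \<omega>} \<in> sets M" by (rule g_events)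
  have "(LINT \<omega>:A|M. eps (Suc n) \<omega>)
      = (\<integral>\<omega>. 2 * indicator (A \<inter> {\<omega> \<in> space M. g (Suc n) \<omega>}) \<omega> - indicator A \<omega> \<partial>M)"
    unfolding set_lebesgue_integral_def
    by (intro Bochner_Integration.integral_cong) (auto simp: erw_sign_def indicator_def)
  also have "\<dots> = 2 * measure M (A \<inter> {\<omega> \<in> space M. g (Suc n) \<omega>}) - measure M A"
    by (subst Bochner_Integration.integral_diff)
       (auto simp: emeasure_eq_measure intro!: integrable_real_indicator)
  finally have lhs: "(LINT \<omega>:A|M. eps (Suc n) \<omega>)
      = 2 * measure M (A \<inter> {\<omega> \<in> space M. g (Suc n) \<omega>}) - measure M A" .
  show ?thesis
  \<comment> \<open>At time 0 the sigma-algebra is trivial and \<open>g_first\<close> replaces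
    \<open>g_step\<close>, which starts at time 1.\<close>
  proof (cases "n = 0")
    case True
    have "sets (F 0) = {{}, space M}"
      by (simp add: sets_F sigma_sets_empty_eq)
    then consider "A = {}" | "A = space M"
      using A True by auto
    then show ?thesis
    proof cases
      case 1
      then show ?thesis by (simp add: set_lebesgue_integral_def)
    next
      case 2
      have "space M \<inter> {\<omega> \<in> space M. g (Suc 0) \<omega>} = {\<omega> \<in> space M. g 1 \<omega>}"
        by auto
      then show ?thesis
        using lhs 2 True g_first by (simp add: prob_space set_lebesgue_integral_def)
    qed
  next
    case False
    have "(p * A_cnt g n \<omega> + (1 - p) * B_cnt g n \<omega>) / real n = (1 + q * mean_step n \<omega>) / 2" for \<omega>
    proof -
      have "2 * (p * A_cnt g n \<omega> + (1 - p) * B_cnt g n \<omega>) = real n + q * W_erw g n \<omega>"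
        unfolding A_cnt_plus_B_cnt[of g n \<omega>, symmetric] W_erw_def q_def by (simp add: algebra_simps)
      then show ?thesis
        using False by (simp add: mean_step_def field_simps)
    qed
    then have "2 * measure M (A \<inter> {\<omega> \<in> space M. g (Suc n) \<omega>}) = 2 * (LINT \<omega>:A|M. (1 + q * mean_step n \<omega>) / 2)"
      using g_step[of n A] A False by (simp only:)
    also have "\<dots> = (LINT \<omega>:A|M. 1 + q * mean_step n \<omega>)"
      by simp
    also have "\<dots> = (LINT \<omega>:A|M. 1) + (LINT \<omega>:A|M. q * mean_step n \<omega>)"
    proof (rule set_integral_add)
      show "set_integrable M A (\<lambda>\<omega>. q * mean_step n \<omega>)"
        unfolding set_integrable_def
        by (intro integrable_mult_indicator AM Bochner_Integration.integrable_mult_right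
            integrable_bounded[OF _ abs_mean_step_le]) auto
    qed (auto simp: set_integrable_def emeasure_eq_measure intro!: integrable_real_indicator)
    also have "(LINT \<omega>:A|M. 1) = measure M A"
      by (simp add: set_lebesgue_integral_def)
    finally show ?thesis
      using lhs by simp
  qed
qed

text \<open>The martingale difference property, extended from events of the past to bounded
  functions of the past via the conditional expectation. All cross terms below vanish because of
  it.\<close>

lemma integral_mult_innov:
  assumes Y: "Y \<in> borel_measurable (F n)" and bound: "\<And>\<omega>. \<bar>Y \<omega>\<bar> \<le> B"
  shows "(\<integral>\<omega>. Y \<omega> * innov n \<omega> \<partial>M) = 0"
proof -
  interpret S: finite_measure_subalgebra M "F n"
    by unfold_locales (rule subalg_F)
  have [measurable]: "Y \<in> borel_measurable M"
    using Y by (rule F_borel_M)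
  have B: "0 \<le> B" using bound order_trans[OF abs_ge_zero] by blast
  have int1: "integrable M (\<lambda>\<omega>. Y \<omega> * eps (Suc n) \<omega>)"
    using bound by (intro integrable_bounded[of _ B]) (auto simp: abs_mult)
  have int2: "integrable M (\<lambda>\<omega>. Y \<omega> * (q * mean_step n \<omega>))"
  proof (intro integrable_bounded[of _ "B * 1"])
    show "\<bar>Y \<omega> * (q * mean_step n \<omega>)\<bar> \<le> B * 1" for \<omega>
      unfolding abs_mult using q_bounds(3) abs_mean_step_le[of n \<omega>] bound B
      by (intro mult_mono mult_le_one) auto
  qed auto
  have "AE \<omega> in M. real_cond_exp M (F n) (eps (Suc n)) \<omega> = q * mean_step n \<omega>"
  proof (rule S.real_cond_exp_charact)
    show "integrable M (eps (Suc n))"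
      by (rule integrable_bounded[of _ 1]) auto
    show "integrable M (\<lambda>\<omega>. q * mean_step n \<omega>)"
      by (intro Bochner_Integration.integrable_mult_right integrable_bounded[OF _ abs_mean_step_le]) auto
    show "(\<lambda>\<omega>. q * mean_step n \<omega>) \<in> borel_measurable (F n)"
      by (intro borel_measurable_times borel_measurable_const mean_step_measurable_F) auto
  qed (rule set_integral_erw_sign)
  then have "(\<integral>\<omega>. Y \<omega> * real_cond_exp M (F n) (eps (Suc n)) \<omega> \<partial>M) = (\<integral>\<omega>. Y \<omega> * (q * mean_step n \<omega>) \<partial>M)"
    by (intro integral_cong_AE) (auto intro!: borel_measurable_times F_borel_M[OF borel_measurable_cond_exp] elim!: eventually_mono)
  moreover have "(\<integral>\<omega>. Y \<omega> * real_cond_exp M (F n) (eps (Suc n)) \<omega> \<partial>M) = (\<integral>\<omega>. Y \<omega> * eps (Suc n) \<omega> \<partial>M)"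
    by (rule S.real_cond_exp_intg(2)) (auto simp: int1 Y)
  ultimately show ?thesis
    using int1 int2 by (simp add: innov_def right_diff_distrib)
qed

section \<open>Second moments and the decay of the mean step\<close>

definition s2 :: "nat \<Rightarrow> real" where
  "s2 n = (\<integral>\<omega>. (mean_step n \<omega>)\<^sup>2 \<partial>M)"

lemma integrable_mean_step_sq: "integrable M (\<lambda>\<omega>. (mean_step n \<omega>)\<^sup>2)"
  by (rule integrable_bounded[of _ 1]) (auto simp: abs_square_le_1 abs_mean_step_le)

lemma s2_0 [simp]: "s2 0 = 0"
  by (simp add: s2_def)

lemma s2_nonneg: "0 \<le> s2 n"
  unfolding s2_def by simp

text \<open>Since signs square to 1, the square of an innovation is a function of the past plus a
  term linear in the innovation, and \<open>integral_mult_innov\<close> removes the latter.\<close>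

lemma innov_sq: "(innov n \<omega>)\<^sup>2 = 1 - q\<^sup>2 * (mean_step n \<omega>)\<^sup>2 - 2 * q * (mean_step n \<omega> * innov n \<omega>)"
proof -
  have "(eps (Suc n) \<omega>)\<^sup>2 = 1"
    by (simp add: erw_sign_def)
  moreover have "eps (Suc n) \<omega> = innov n \<omega> + q * mean_step n \<omega>"
    by (simp add: innov_def)
  ultimately show ?thesis
    by algebra
qed

text \<open>This identifies the conditional variance of an innovation. Taking \<open>Y\<close>
  constant yields \<open>e2\<close>, taking it to be an indicator yields the predictable quadratic
  variation.\<close>

lemma integral_mult_innov_sq:
  assumes Y: "Y \<in> borel_measurable (F n)" and bound: "\<And>\<omega>. \<bar>Y \<omega>\<bar> \<le> B"
  shows "(\<integral>\<omega>. Y \<omega> * (innov n \<omega>)\<^sup>2 \<partial>M) = (\<integral>\<omega>. Y \<omega> * (1 - q\<^sup>2 * (mean_step n \<omega>)\<^sup>2) \<partial>M)"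
proof -
  have [measurable]: "Y \<in> borel_measurable M"
    using Y by (rule F_borel_M)
  have B: "0 \<le> B" using bound order_trans[OF abs_ge_zero] by blast
  have YB: "\<bar>Y \<omega> * mean_step n \<omega>\<bar> \<le> B * 1" for \<omega>
    unfolding abs_mult using bound abs_mean_step_le B by (intro mult_mono) auto
  have zero: "(\<integral>\<omega>. (Y \<omega> * mean_step n \<omega>) * innov n \<omega> \<partial>M) = 0"
    by (rule integral_mult_innov[OF _ YB]) (intro borel_measurable_times Y mean_step_measurable_F order_refl)
  have int1: "integrable M (\<lambda>\<omega>. (Y \<omega> * mean_step n \<omega>) * innov n \<omega>)"
  proof (rule integrable_bounded[of _ "B * 1 * 2"])
    show "\<bar>(Y \<omega> * mean_step n \<omega>) * innov n \<omega>\<bar> \<le> B * 1 * 2" for \<omega>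
      unfolding abs_mult[of _ "innov n \<omega>"] using YB B abs_innov_le by (intro mult_mono) auto
  qed auto
  have int2: "integrable M (\<lambda>\<omega>. Y \<omega> * (1 - q\<^sup>2 * (mean_step n \<omega>)\<^sup>2))"
  proof (rule integrable_bounded[of _ "B * 1"])
    fix \<omega>
    have "q\<^sup>2 * (mean_step n \<omega>)\<^sup>2 \<le> 1"
      using q_bounds(3) abs_mean_step_le[of n \<omega>] by (intro mult_le_one) (auto simp: abs_square_le_1)
    then show "\<bar>Y \<omega> * (1 - q\<^sup>2 * (mean_step n \<omega>)\<^sup>2)\<bar> \<le> B * 1"
      unfolding abs_mult using bound B by (intro mult_mono) auto
  qed auto
  have "(\<integral>\<omega>. Y \<omega> * (innov n \<omega>)\<^sup>2 \<partial>M)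
      = (\<integral>\<omega>. Y \<omega> * (1 - q\<^sup>2 * (mean_step n \<omega>)\<^sup>2) - 2 * q * ((Y \<omega> * mean_step n \<omega>) * innov n \<omega>) \<partial>M)"
    unfolding innov_sq by (simp add: algebra_simps)
  also have "\<dots> = (\<integral>\<omega>. Y \<omega> * (1 - q\<^sup>2 * (mean_step n \<omega>)\<^sup>2) \<partial>M)"
    using int1 int2 zero by simp
  finally show ?thesis .
qed

definition e2 :: "nat \<Rightarrow> real" where
  "e2 n = (\<integral>\<omega>. (innov n \<omega>)\<^sup>2 \<partial>M)"

lemma integrable_innov_sq: "integrable M (\<lambda>\<omega>. (innov n \<omega>)\<^sup>2)"
proof (rule integrable_bounded[of _ "2\<^sup>2"])
  show "\<bar>(innov n \<omega>)\<^sup>2\<bar> \<le> 2\<^sup>2" for \<omega>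
    using power_mono[OF abs_innov_le[of n \<omega>], of 2] by simp
qed auto

lemma e2_eq: "e2 n = 1 - q\<^sup>2 * s2 n"
  using integral_mult_innov_sq[of "\<lambda>_. 1" n 1] integrable_mean_step_sq
  by (simp add: e2_def s2_def prob_space)

lemma e2_bounds: "0 \<le> e2 n" "e2 n \<le> 1"
  by (simp add: e2_def) (simp add: e2_eq s2_nonneg)

lemma mean_step_Suc:
  "mean_step (Suc n) \<omega> = (real n + q) / (real n + 1) * mean_step n \<omega> + innov n \<omega> / (real n + 1)"
proof -
  have W: "W_erw g n \<omega> = real n * mean_step n \<omega>"
    by (cases "n = 0") (auto simp: mean_step_def W_erw_eq_sum)
  have "mean_step (Suc n) \<omega> = (W_erw g n \<omega> + eps (Suc n) \<omega>) / (real n + 1)"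
    by (simp add: mean_step_def W_erw_eq_sum add.commute)
  also have "\<dots> = ((real n + q) * mean_step n \<omega> + innov n \<omega>) / (real n + 1)"
    unfolding W by (simp add: innov_def algebra_simps)
  finally show ?thesis
    by (simp only: add_divide_distrib[of "_ * _"] times_divide_eq_left)
qed

lemma abs_mean_step_diff_le: "\<bar>mean_step (Suc n) \<omega> - mean_step n \<omega>\<bar> \<le> 2 / (real n + 1)"
proof -
  have "(real n + q) / (real n + 1) = 1 - (1 - q) / (real n + 1)"
    by (simp add: field_simps)
  then have "mean_step (Suc n) \<omega> - mean_step n \<omega> = (innov n \<omega> - (1 - q) * mean_step n \<omega>) / (real n + 1)"
    unfolding mean_step_Suc by (simp add: diff_divide_distrib left_diff_distrib)
  also have "\<dots> = (eps (Suc n) \<omega> - mean_step n \<omega>) / (real n + 1)"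
    by (simp add: innov_def algebra_simps)
  also have "\<bar>\<dots>\<bar> \<le> 2 / (real n + 1)"
    using abs_mean_step_le[of n \<omega>] abs_erw_sign[of "Suc n" \<omega>]
    by (simp only: abs_divide) (intro divide_mono, linarith+)
  finally show ?thesis .
qed

lemma s2_Suc: "s2 (Suc n) = ((real n + q) / (real n + 1))\<^sup>2 * s2 n + e2 n / (real n + 1)\<^sup>2"
proof -
  define r where "r = (real n + q) / (real n + 1)"
  define t where "t = 1 / (real n + 1)"
  have c: "mean_step (Suc n) \<omega> = r * mean_step n \<omega> + t * innov n \<omega>" for \<omega>
    by (simp add: mean_step_Suc r_def t_def)
  have zero: "(\<integral>\<omega>. mean_step n \<omega> * innov n \<omega> \<partial>M) = 0"
    by (rule integral_mult_innov[OF mean_step_measurable_F abs_mean_step_le]) simp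
  have int: "integrable M (\<lambda>\<omega>. mean_step n \<omega> * innov n \<omega>)"
  proof (rule integrable_bounded[of _ "1 * 2"])
    show "\<bar>mean_step n \<omega> * innov n \<omega>\<bar> \<le> 1 * 2" for \<omega>
      unfolding abs_mult using abs_mean_step_le abs_innov_le by (intro mult_mono) auto
  qed auto
  have "s2 (Suc n) = (\<integral>\<omega>. r\<^sup>2 * (mean_step n \<omega>)\<^sup>2 + 2 * r * t * (mean_step n \<omega> * innov n \<omega>) + t\<^sup>2 * (innov n \<omega>)\<^sup>2 \<partial>M)"
    unfolding s2_def c by (intro Bochner_Integration.integral_cong refl) (simp add: power2_eq_square algebra_simps)
  also have "\<dots> = r\<^sup>2 * s2 n + t\<^sup>2 * e2 n"
    using int zero integrable_mean_step_sq integrable_innov_sq by (simp add: s2_def e2_def)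
  finally show ?thesis
    by (simp add: r_def t_def power_divide)
qed

text \<open>The contraction factor \<open>r = 1 - (1 - q) / (n + 1)\<close> satisfies
  \<open>r\<^sup>2 \<le> r\<close>, so each step removes at least
  \<open>(1 - q) * s2 n / (n + 1)\<close> and adds at most \<open>1 / (n + 1)\<^sup>2\<close>.
  Telescoping bounds the partial sums, and \<open>q < 1\<close> allows division by
  \<open>1 - q\<close>.\<close>

lemma summable_s2: "summable (\<lambda>n. s2 n / (real n + 1))"
proof -
  have step: "(1 - q) * (s2 n / (real n + 1)) \<le> s2 n - s2 (Suc n) + 1 / (real n + 1)\<^sup>2" for n
  \<comment> \<open>For \<open>n = 0\<close> the factor \<open>r\<close> equals \<open>q\<close> and
    may be negative, but \<open>s2 0 = 0\<close>.\<close>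
  proof (cases "n = 0")
    case True
    then show ?thesis
      using e2_bounds(2)[of 0] by (simp add: s2_Suc[of 0])
  next
    case False
    define r where "r = (real n + q) / (real n + 1)"
    have r: "0 \<le> r" "r \<le> 1" "1 - r = (1 - q) / (real n + 1)"
      using False q_bounds by (auto simp: r_def field_simps)
    have "r\<^sup>2 * s2 n \<le> r * s2 n"
      using r s2_nonneg[of n] by (intro mult_right_mono) (auto simp: power2_eq_square mult_left_le)
    moreover have "e2 n / (real n + 1)\<^sup>2 \<le> 1 / (real n + 1)\<^sup>2"
      using e2_bounds(2)[of n] by (intro divide_right_mono) auto
    ultimately have "s2 (Suc n) \<le> r * s2 n + 1 / (real n + 1)\<^sup>2"
      unfolding s2_Suc r_def[symmetric] by linarith
    moreover have "(1 - q) * (s2 n / (real n + 1)) = s2 n - r * s2 n"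
      using arg_cong[OF r(3), of "\<lambda>z. z * s2 n"] by (simp add: left_diff_distrib)
    ultimately show ?thesis by linarith
  qed
  have "summable (\<lambda>n. (1 - q) * (s2 n / (real n + 1)))"
  proof (rule summableI_nonneg_bounded)
    show "0 \<le> (1 - q) * (s2 n / (real n + 1))" for n
      using q_bounds s2_nonneg[of n] by simp
    show "(\<Sum>n<N. (1 - q) * (s2 n / (real n + 1))) \<le> (\<Sum>n. 1 / (real n + 1)\<^sup>2)" for N
    proof -
      have "(\<Sum>n<N. (1 - q) * (s2 n / (real n + 1))) \<le> (\<Sum>n<N. s2 n - s2 (Suc n) + 1 / (real n + 1)\<^sup>2)"
        by (intro sum_mono step)
      also have "\<dots> = s2 0 - s2 N + (\<Sum>n<N. 1 / (real n + 1)\<^sup>2)"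
        by (simp only: sum.distrib sum_lessThan_telescope')
      also have "\<dots> \<le> (\<Sum>n. 1 / (real n + 1)\<^sup>2)"
        using s2_nonneg[of N] sum_le_suminf[OF summable_inverse_Suc_squares, of "{..<N}"] by simp
      finally show ?thesis .
    qed
  qed
  then show ?thesis
    using q_bounds by (subst (asm) summable_cmult_iff) auto
qed

lemma mean_step_tendsto_zero: "AE \<omega> in M. (\<lambda>n. mean_step n \<omega>) \<longlonglongrightarrow> 0"
proof -
  have "AE \<omega> in M. summable (\<lambda>n. (mean_step n \<omega>)\<^sup>2 / (real n + 1))"
  proof (rule AE_summable_of_summable_integral)
    show "integrable M (\<lambda>\<omega>. (mean_step n \<omega>)\<^sup>2 / (real n + 1))" for n
      by (intro Bochner_Integration.integrable_divide integrable_mean_step_sq)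
    show "summable (\<lambda>n. \<integral>\<omega>. (mean_step n \<omega>)\<^sup>2 / (real n + 1) \<partial>M)"
      using summable_s2 by (simp add: s2_def)
  qed auto
  then show ?thesis
  proof eventually_elim
    case (elim \<omega>)
    have "(\<lambda>n. (mean_step n \<omega>)\<^sup>2) \<longlonglongrightarrow> 0"
    proof (rule slowly_varying_tendsto_zero[OF _ _ elim])
      fix n
      have "(mean_step (Suc n) \<omega>)\<^sup>2 - (mean_step n \<omega>)\<^sup>2
          = (mean_step (Suc n) \<omega> - mean_step n \<omega>) * (mean_step (Suc n) \<omega> + mean_step n \<omega>)"
        by (simp add: power2_eq_square algebra_simps)
      also have "\<bar>\<dots>\<bar> \<le> 2 / (real n + 1) * 2"
        unfolding abs_mult
        using abs_mean_step_diff_le[of n \<omega>] abs_mean_step_le[of n \<omega>] abs_mean_step_le[of "Suc n" \<omega>]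
        by (intro mult_mono) auto
      finally show "\<bar>(mean_step (Suc n) \<omega>)\<^sup>2 - (mean_step n \<omega>)\<^sup>2\<bar> \<le> 4 / (real n + 1)"
        by simp
    qed simp
    then have "(\<lambda>n. sqrt ((mean_step n \<omega>)\<^sup>2)) \<longlonglongrightarrow> sqrt 0"
      by (rule tendsto_real_sqrt)
    then show ?case
      by (simp add: tendsto_rabs_zero_iff)
  qed
qed

lemma s2_tendsto_zero: "s2 \<longlonglongrightarrow> 0"
proof -
  have "(\<lambda>n. \<integral>\<omega>. (mean_step n \<omega>)\<^sup>2 \<partial>M) \<longlonglongrightarrow> (\<integral>\<omega>. 0 \<partial>M)"
  proof (rule integral_dominated_convergence[where w = "\<lambda>_. 1"])
    show "AE \<omega> in M. (\<lambda>n. (mean_step n \<omega>)\<^sup>2) \<longlonglongrightarrow> 0"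
      using mean_step_tendsto_zero by eventually_elim (auto intro!: tendsto_eq_intros)
    show "AE \<omega> in M. norm ((mean_step n \<omega>)\<^sup>2) \<le> 1" for n
      by (simp add: abs_square_le_1 abs_mean_step_le)
  qed auto
  then show ?thesis
    by (simp add: s2_def[abs_def])
qed

section \<open>Weighted sums of innovations, covering both \<open>Mart\<close> and
  \<open>Xi\<close>\<close>

lemma innov_sum_measurable_F: "n \<le> N \<Longrightarrow> (\<lambda>\<omega>. \<Sum>k=m..<n. a k * innov k \<omega>) \<in> borel_measurable (F N)"
  by (intro borel_measurable_sum borel_measurable_times borel_measurable_const innov_measurable_F) auto

lemma abs_innov_sum_le: "\<bar>\<Sum>k=m..<n. a k * innov k \<omega>\<bar> \<le> (\<Sum>k=m..<n. \<bar>a k\<bar> * 2)"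
  by (rule order_trans[OF sum_abs]) (auto intro!: sum_mono mult_left_mono abs_innov_le simp: abs_mult)

lemma integrable_innov_sum_sq: "integrable M (\<lambda>\<omega>. (\<Sum>k=m..<n. a k * innov k \<omega>)\<^sup>2)"
proof (rule integrable_bounded)
  show "\<bar>(\<Sum>k=m..<n. a k * innov k \<omega>)\<^sup>2\<bar> \<le> (\<Sum>k=m..<n. \<bar>a k\<bar> * 2)\<^sup>2" for \<omega>
    using power_mono[OF abs_innov_sum_le[of a \<omega> m n], of 2] by simp
qed measurable

text \<open>Pythagoras: the partial sum \<open>Y\<close> belongs to the past of the next innovation,
  so the mixed term integrates to zero.\<close>

lemma integral_innov_sum_sq:
  assumes "m \<le> n"
  shows "(\<integral>\<omega>. (\<Sum>k=m..<n. a k * innov k \<omega>)\<^sup>2 \<partial>M) = (\<Sum>k=m..<n. (a k)\<^sup>2 * e2 k)"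
  using assms
proof (induction n rule: dec_induct)
  case (step n)
  define Y where "Y \<omega> = (\<Sum>k=m..<n. a k * innov k \<omega>)" for \<omega>
  have YF: "Y \<in> borel_measurable (F n)"
    unfolding Y_def[abs_def] by (rule innov_sum_measurable_F) simp
  have [measurable]: "Y \<in> borel_measurable M"
    using YF by (rule F_borel_M)
  have YB: "\<bar>Y \<omega>\<bar> \<le> (\<Sum>k=m..<n. \<bar>a k\<bar> * 2)" for \<omega>
    unfolding Y_def by (rule abs_innov_sum_le)
  have int: "integrable M (\<lambda>\<omega>. Y \<omega> * innov n \<omega>)"
  proof (rule integrable_bounded)
    show "\<bar>Y \<omega> * innov n \<omega>\<bar> \<le> (\<Sum>k=m..<n. \<bar>a k\<bar> * 2) * 2" for \<omega>
      unfolding abs_mult using YB abs_innov_le by (intro mult_mono) (auto intro: sum_nonneg)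
  qed auto
  have intY: "integrable M (\<lambda>\<omega>. (Y \<omega>)\<^sup>2)"
    unfolding Y_def by (rule integrable_innov_sum_sq)
  have "(\<integral>\<omega>. (\<Sum>k=m..<Suc n. a k * innov k \<omega>)\<^sup>2 \<partial>M)
      = (\<integral>\<omega>. (Y \<omega>)\<^sup>2 + 2 * a n * (Y \<omega> * innov n \<omega>) + (a n)\<^sup>2 * (innov n \<omega>)\<^sup>2 \<partial>M)"
    using step.hyps by (intro Bochner_Integration.integral_cong refl)
      (simp add: Y_def power2_eq_square algebra_simps)
  also have "\<dots> = (\<integral>\<omega>. (Y \<omega>)\<^sup>2 \<partial>M) + (a n)\<^sup>2 * e2 n"
    using int intY integrable_innov_sq integral_mult_innov[OF YF YB] by (simp add: e2_def)
  finally show ?case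
    using step by (simp add: Y_def)
qed simp

lemma integral_innov_sum: "(\<integral>\<omega>. (\<Sum>k=m..<n. a k * innov k \<omega>) \<partial>M) = 0"
proof -
  have "integrable M (innov k)" for k
    by (rule integrable_bounded[OF _ abs_innov_le]) auto
  moreover have "(\<integral>\<omega>. innov k \<omega> \<partial>M) = 0" for k
    using integral_mult_innov[of "\<lambda>_. 1" k 1] by simp
  ultimately show ?thesis
    by simp
qed

section \<open>The martingale behind the alternating sum\<close>

text \<open>For \<open>n \<ge> 1\<close> this is the hypergeometric value \<open>F\<close> named
  above \<open>hyp_excess\<close>. The value \<open>1 / 2\<close> at \<open>n = 0\<close> is a
  default; it only ever multiplies \<open>mean_step 0\<close> or \<open>s2 0\<close>, which are
  zero.\<close>

definition H :: "nat \<Rightarrow> real" where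
  "H n = (1 + hyp_excess q n) / 2"

lemma H_nonneg: "0 \<le> H n"
  using hyp_excess_nonneg[of q n] q_bounds by (simp add: H_def)

lemma H_le_1: "H n \<le> 1"
proof (cases "n = 0")
  case False
  have "hyp_excess q n \<le> (1 - q) / (real n + 1)"
    using False q_bounds by (intro hyp_excess_le) auto
  also have "\<dots> \<le> 1"
    using False q_bounds by (simp add: field_simps)
  finally show ?thesis by (simp add: H_def)
qed (simp add: H_def)

lemma H_recurrence:
  assumes "n \<ge> 1"
  shows "H n = 1 - (real n + q) / (real n + 1) * H (Suc n)"
proof -
  have "(real n + 1) * (2 * H n - 1) + (real n + q) * (2 * H (Suc n) - 1) = 1 - q"
    using hyp_excess_recurrence[OF assms, of q] by (simp add: H_def add_divide_distrib)
  then have "(real n + 1) * H n = (real n + 1) - (real n + q) * H (Suc n)"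
    by (simp add: algebra_simps)
  then show ?thesis
    by (simp add: field_simps)
qed

definition mcoef :: "nat \<Rightarrow> real" where
  "mcoef k = (-1) ^ Suc k * H (Suc k) / (real k + 1)"

definition Mart :: "nat \<Rightarrow> 'a \<Rightarrow> real" where
  "Mart n \<omega> = (\<Sum>k=0..<n. mcoef k * innov k \<omega>)"

lemma abs_mcoef_le: "\<bar>mcoef k\<bar> \<le> 1 / (real k + 1)"
  using H_nonneg[of "Suc k"] H_le_1[of "Suc k"] by (simp add: mcoef_def abs_mult power_abs divide_right_mono)

text \<open>The recurrence for \<open>H\<close> is designed for this: the part of the new boundary
  term that depends on the past turns \<open>H n * mean_step n\<close> into the new summand
  \<open>mean_step n\<close>.\<close>

lemma Mart_eq: "Mart n \<omega> = (\<Sum>k<n. (-1) ^ k * mean_step k \<omega>) + (-1) ^ n * H n * mean_step n \<omega>"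
proof (induction n)
  case (Suc n)
  define r where "r = (real n + q) / (real n + 1)"
  have "mean_step (Suc n) \<omega> = r * mean_step n \<omega> + innov n \<omega> / (real n + 1)"
    by (simp add: mean_step_Suc r_def)
  then have d: "innov n \<omega> / (real n + 1) = mean_step (Suc n) \<omega> - r * mean_step n \<omega>"
    by simp
  \<comment> \<open>The recurrence starts at 1; for \<open>n = 0\<close> both sides vanish with
    \<open>mean_step 0\<close>.\<close>
  have H: "H n * mean_step n \<omega> = (1 - r * H (Suc n)) * mean_step n \<omega>"
    by (cases "n = 0") (auto simp: r_def H_recurrence[of n])
  have "Mart (Suc n) \<omega> = Mart n \<omega> + (-1) ^ Suc n * H (Suc n) * (innov n \<omega> / (real n + 1))"
    by (simp add: Mart_def mcoef_def)
  also have "\<dots> = (\<Sum>k<n. (-1) ^ k * mean_step k \<omega>) + (-1) ^ n * (H n * mean_step n \<omega>)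
      + (-1) ^ Suc n * H (Suc n) * (mean_step (Suc n) \<omega> - r * mean_step n \<omega>)"
    unfolding Suc d by simp
  also have "\<dots> = (\<Sum>k<Suc n. (-1) ^ k * mean_step k \<omega>) + (-1) ^ Suc n * H (Suc n) * mean_step (Suc n) \<omega>"
    unfolding H by (simp add: algebra_simps)
  finally show ?case .
qed (simp add: Mart_def)

lemma Mart_measurable [measurable]: "Mart n \<in> borel_measurable M"
  unfolding Mart_def[abs_def] by measurable

lemma Mart_diff: "m \<le> n \<Longrightarrow> Mart n \<omega> - Mart m \<omega> = (\<Sum>k=m..<n. mcoef k * innov k \<omega>)"
  unfolding Mart_def using sum.atLeastLessThan_concat[of 0 m n "\<lambda>k. mcoef k * innov k \<omega>"] by simp

lemma integrable_Mart_diff_sq: "m \<le> n \<Longrightarrow> integrable M (\<lambda>\<omega>. (Mart n \<omega> - Mart m \<omega>)\<^sup>2)"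
  by (simp add: Mart_diff integrable_innov_sum_sq)

lemma integral_Mart_diff_sq_le:
  assumes "1 \<le> m" "m \<le> n"
  shows "(\<integral>\<omega>. (Mart n \<omega> - Mart m \<omega>)\<^sup>2 \<partial>M) \<le> 1 / real m"
proof -
  have "(\<integral>\<omega>. (Mart n \<omega> - Mart m \<omega>)\<^sup>2 \<partial>M) = (\<Sum>k=m..<n. (mcoef k)\<^sup>2 * e2 k)"
    using assms by (simp add: Mart_diff integral_innov_sum_sq)
  also have "\<dots> \<le> (\<Sum>k=m..<n. 1 / (real k + 1)\<^sup>2)"
  proof (rule sum_mono)
    fix k
    have "(mcoef k)\<^sup>2 \<le> 1 / (real k + 1)\<^sup>2"
      using power_mono[OF abs_mcoef_le[of k], of 2] by (simp add: power_divide)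
    then show "(mcoef k)\<^sup>2 * e2 k \<le> 1 / (real k + 1)\<^sup>2"
      using e2_bounds[of k] mult_mono[of "(mcoef k)\<^sup>2" "1 / (real k + 1)\<^sup>2" "e2 k" 1] by simp
  qed
  also have "\<dots> \<le> 1 / real m - 1 / real n"
    using assms by (rule sum_inverse_squares_le)
  also have "\<dots> \<le> 1 / real m"
    by simp
  finally show ?thesis .
qed

text \<open>With \<open>x = r * H (Suc n)\<close> and \<open>H n = 1 - x\<close>, the difference
  \<open>(1 - x)\<^sup>2 - x\<^sup>2 = 1 - 2 * x\<close> equals \<open>2 * H n - 1\<close>. This is
  how the weight \<open>hyp_excess q n\<close> arises when the variance increments are summed by
  parts.\<close>

lemma integral_Mart_sq:
  "(\<integral>\<omega>. (Mart n \<omega>)\<^sup>2 \<partial>M) = (H n)\<^sup>2 * s2 n + (\<Sum>k<n. s2 k * hyp_excess q k)"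
proof -
  have "(\<Sum>k=0..<n. (mcoef k)\<^sup>2 * e2 k) = (H n)\<^sup>2 * s2 n + (\<Sum>k<n. s2 k * hyp_excess q k)"
  proof (induction n)
    case (Suc n)
    define r where "r = (real n + q) / (real n + 1)"
    have "s2 (Suc n) = r\<^sup>2 * s2 n + e2 n / (real n + 1)\<^sup>2"
      by (simp add: s2_Suc r_def)
    moreover have "(mcoef n)\<^sup>2 * e2 n = (H (Suc n))\<^sup>2 * (e2 n / (real n + 1)\<^sup>2)"
      by (simp add: mcoef_def power_divide power_mult_distrib flip: power_mult)
    moreover have "s2 n * (H n)\<^sup>2 = s2 n * ((r * H (Suc n))\<^sup>2 + hyp_excess q n)"
    proof (cases "n = 0")
      case False
      then have "H n = 1 - r * H (Suc n)"
        by (simp add: r_def H_recurrence[of n])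
      moreover have "hyp_excess q n = 2 * H n - 1"
        by (simp add: H_def add_divide_distrib)
      ultimately have "(H n)\<^sup>2 = (r * H (Suc n))\<^sup>2 + hyp_excess q n"
        by algebra
      then show ?thesis by simp
    qed simp
    ultimately have "(H n)\<^sup>2 * s2 n + (mcoef n)\<^sup>2 * e2 n = (H (Suc n))\<^sup>2 * s2 (Suc n) + s2 n * hyp_excess q n"
      by algebra
    with Suc show ?case by simp
  qed simp
  then show ?thesis
    unfolding Mart_def by (simp add: integral_innov_sum_sq)
qed

lemma abs_Mart_diff_le: "\<bar>Mart (Suc n) \<omega> - Mart n \<omega>\<bar> \<le> 2 / (real n + 1)"
proof -
  have "\<bar>Mart (Suc n) \<omega> - Mart n \<omega>\<bar> = \<bar>mcoef n\<bar> * \<bar>innov n \<omega>\<bar>"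
    by (simp add: Mart_def abs_mult)
  also have "\<dots> \<le> 1 / (real n + 1) * 2"
    using abs_mcoef_le abs_innov_le by (intro mult_mono) auto
  finally show ?thesis by simp
qed

text \<open>The block increments \<open>D j\<close> along fourth powers have second moment at most
  \<open>1 / (j + 1) ^ 4\<close>, so their squares weighted by \<open>(j + 1)\<^sup>2\<close> are
  almost surely summable; within blocks the increments of size O(1/n) suffice.\<close>

lemma Mart_convergent: "AE \<omega> in M. convergent (\<lambda>n. Mart n \<omega>)"
proof -
  define D where "D j \<omega> = Mart (Suc (Suc j) ^ 4) \<omega> - Mart (Suc j ^ 4) \<omega>" for j \<omega>
  have le: "Suc j ^ 4 \<le> Suc (Suc j) ^ 4" for j
    by (rule power_mono) auto
  have int_D: "integrable M (\<lambda>\<omega>. (D j \<omega>)\<^sup>2)" for j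
    unfolding D_def by (rule integrable_Mart_diff_sq[OF le])
  have "AE \<omega> in M. summable (\<lambda>j. (real j + 1)\<^sup>2 * (D j \<omega>)\<^sup>2)"
  proof (rule AE_summable_of_summable_integral)
    show "integrable M (\<lambda>\<omega>. (real j + 1)\<^sup>2 * (D j \<omega>)\<^sup>2)" for j
      by (intro Bochner_Integration.integrable_mult_right int_D)
    show "summable (\<lambda>j. \<integral>\<omega>. (real j + 1)\<^sup>2 * (D j \<omega>)\<^sup>2 \<partial>M)"
    proof (rule summable_comparison_test'[OF summable_inverse_Suc_squares, of 0])
      fix j :: nat
      have "(\<integral>\<omega>. (D j \<omega>)\<^sup>2 \<partial>M) \<le> 1 / real (Suc j ^ 4)"
        unfolding D_def by (rule integral_Mart_diff_sq_le[OF _ le]) simp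
      then have "(real j + 1)\<^sup>2 * (\<integral>\<omega>. (D j \<omega>)\<^sup>2 \<partial>M) \<le> (real j + 1)\<^sup>2 * (1 / (real j + 1) ^ 4)"
        by (intro mult_left_mono) (auto simp: add.commute)
      also have "\<dots> = 1 / (real j + 1)\<^sup>2"
        by (simp add: power2_eq_square power4_eq_xxxx)
      finally show "norm (\<integral>\<omega>. (real j + 1)\<^sup>2 * (D j \<omega>)\<^sup>2 \<partial>M) \<le> 1 / (real j + 1)\<^sup>2"
        by simp
    qed
  qed simp
  then show ?thesis
  proof eventually_elim
    case (elim \<omega>)
    \<comment> \<open>The inequality of arithmetic and geometric means turns weighted square
      summability into absolute summability.\<close>
    have "norm (D j \<omega>) \<le> 1 / 2 * ((real j + 1)\<^sup>2 * (D j \<omega>)\<^sup>2 + 1 / (real j + 1)\<^sup>2)" for j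
    proof -
      have "0 \<le> ((real j + 1) * \<bar>D j \<omega>\<bar> - 1 / (real j + 1))\<^sup>2"
        by simp
      also have "\<dots> = (real j + 1)\<^sup>2 * (D j \<omega>)\<^sup>2 + 1 / (real j + 1)\<^sup>2 - 2 * \<bar>D j \<omega>\<bar>"
        by (simp add: power2_diff power_mult_distrib power_divide)
      finally show ?thesis by simp
    qed
    then have "summable (\<lambda>j. D j \<omega>)"
      by (rule summable_comparison_test'[rotated]) (intro summable_mult summable_add elim summable_inverse_Suc_squares)
    then have "convergent (\<lambda>n. Mart (Suc n ^ 4) \<omega> - Mart (Suc 0 ^ 4) \<omega>)"
      unfolding summable_iff_convergent D_def
      by (simp only: sum_lessThan_telescope[of "\<lambda>n. Mart (Suc n ^ 4) \<omega>"])
    then have "convergent (\<lambda>n. Mart (Suc n ^ 4) \<omega> - Mart (Suc 0 ^ 4) \<omega> + Mart (Suc 0 ^ 4) \<omega>)"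
      by (intro convergent_add convergent_const)
    then obtain l where "(\<lambda>n. Mart (Suc n ^ 4) \<omega>) \<longlonglongrightarrow> l"
      by (auto simp: convergent_def)
    then have "(\<lambda>n. Mart (n ^ 4) \<omega>) \<longlonglongrightarrow> l"
      by (rule LIMSEQ_imp_Suc)
    then have "(\<lambda>n. Mart n \<omega>) \<longlonglongrightarrow> l"
      by (rule slowly_varying_tendsto_of_fourth_powers[OF abs_Mart_diff_le])
    then show ?case
      by (auto simp: convergent_def)
  qed
qed

text \<open>This is the limit variable without the factor \<open>q\<close>. Where the series
  diverges, \<open>suminf\<close> gives an unspecified value, which concerns only a null
  set.\<close>

definition S :: "'a \<Rightarrow> real" where
  "S \<omega> = (\<Sum>k. (-1) ^ k * mean_step k \<omega>)"

lemma S_measurable [measurable]: "S \<in> borel_measurable M"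
  unfolding S_def[abs_def] by measurable

text \<open>In \<open>Mart_eq\<close> the boundary term vanishes in the limit, as \<open>H\<close>
  is bounded and \<open>mean_step\<close> tends to 0; the series and the martingale thus share their
  limit.\<close>

lemma sums_S: "AE \<omega> in M. (\<lambda>k. (-1) ^ k * mean_step k \<omega>) sums S \<omega> \<and> (\<lambda>n. Mart n \<omega>) \<longlonglongrightarrow> S \<omega>"
  using Mart_convergent mean_step_tendsto_zero
proof eventually_elim
  case (elim \<omega>)
  then obtain l where l: "(\<lambda>n. Mart n \<omega>) \<longlonglongrightarrow> l"
    by (auto simp: convergent_def)
  have "(\<lambda>n. (-1) ^ n * H n * mean_step n \<omega>) \<longlonglongrightarrow> 0"
  proof (rule tendsto_0_le[OF elim(2), of _ 1])
    show "\<forall>\<^sub>F n in sequentially. norm ((-1) ^ n * H n * mean_step n \<omega>) \<le> norm (mean_step n \<omega>) * 1"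
      using H_nonneg H_le_1 by (intro always_eventually allI) (simp add: abs_mult power_abs mult_left_le_one_le)
  qed
  from tendsto_diff[OF l this] have "(\<lambda>n. \<Sum>k<n. (-1) ^ k * mean_step k \<omega>) \<longlonglongrightarrow> l"
    by (simp add: Mart_eq)
  then have sums: "(\<lambda>k. (-1) ^ k * mean_step k \<omega>) sums l"
    by (simp add: sums_def)
  then have "S \<omega> = l"
    unfolding S_def by (rule sums_unique[symmetric])
  with l sums show ?case by simp
qed

lemma S_Mart_diff_sq:
  assumes "1 \<le> m"
  shows "integrable M (\<lambda>\<omega>. (S \<omega> - Mart m \<omega>)\<^sup>2)" "(\<integral>\<omega>. (S \<omega> - Mart m \<omega>)\<^sup>2 \<partial>M) \<le> 1 / real m"
proof -
  have int: "integrable M (\<lambda>\<omega>. (Mart (n + m) \<omega> - Mart m \<omega>)\<^sup>2)" for n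
    by (rule integrable_Mart_diff_sq) simp
  have le: "(\<integral>\<omega>. (Mart (n + m) \<omega> - Mart m \<omega>)\<^sup>2 \<partial>M) \<le> 1 / real m" for n
    using assms by (intro integral_Mart_diff_sq_le) auto
  have lim: "AE \<omega> in M. (\<lambda>n. (Mart (n + m) \<omega> - Mart m \<omega>)\<^sup>2) \<longlonglongrightarrow> (S \<omega> - Mart m \<omega>)\<^sup>2"
    using sums_S by eventually_elim (intro tendsto_intros LIMSEQ_ignore_initial_segment, simp)
  show "integrable M (\<lambda>\<omega>. (S \<omega> - Mart m \<omega>)\<^sup>2)" "(\<integral>\<omega>. (S \<omega> - Mart m \<omega>)\<^sup>2 \<partial>M) \<le> 1 / real m"
    using fatou_integral_le[OF int _ le _ lim] by auto
qed

lemma Mart_bounded: "\<bar>Mart n \<omega>\<bar> \<le> (\<Sum>k=0..<n. \<bar>mcoef k\<bar> * 2)"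
  unfolding Mart_def by (rule abs_innov_sum_le)

lemma integrable_Mart: "integrable M (Mart n)" "integrable M (\<lambda>\<omega>. (Mart n \<omega>)\<^sup>2)"
proof -
  show "integrable M (Mart n)"
    by (rule integrable_bounded[OF _ Mart_bounded]) measurable
  show "integrable M (\<lambda>\<omega>. (Mart n \<omega>)\<^sup>2)"
    unfolding Mart_def by (rule integrable_innov_sum_sq)
qed

lemma S_square_integrable: "integrable M (\<lambda>\<omega>. (S \<omega>)\<^sup>2)"
proof (rule Bochner_Integration.integrable_bound)
  show "integrable M (\<lambda>\<omega>. 2 * (S \<omega> - Mart 1 \<omega>)\<^sup>2 + 2 * (Mart 1 \<omega>)\<^sup>2)"
    using S_Mart_diff_sq(1)[of 1] integrable_Mart(2)[of 1] by simp
  show "AE \<omega> in M. norm ((S \<omega>)\<^sup>2) \<le> norm (2 * (S \<omega> - Mart 1 \<omega>)\<^sup>2 + 2 * (Mart 1 \<omega>)\<^sup>2)"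
  proof (rule AE_I2)
    fix \<omega>
    \<comment> \<open>This square is exactly the difference of the two sides of the claim.\<close>
    have "0 \<le> (S \<omega> - 2 * Mart 1 \<omega>)\<^sup>2" by simp
    then show "norm ((S \<omega>)\<^sup>2) \<le> norm (2 * (S \<omega> - Mart 1 \<omega>)\<^sup>2 + 2 * (Mart 1 \<omega>)\<^sup>2)"
      by (simp add: power2_eq_square algebra_simps)
  qed
qed measurable

lemma S_integrable: "integrable M S"
  using square_integrable_imp_integrable[OF S_measurable S_square_integrable] by simp

lemma integral_S: "(\<integral>\<omega>. S \<omega> \<partial>M) = 0"
proof -
  have le: "(\<integral>\<omega>. S \<omega> \<partial>M)\<^sup>2 \<le> 1 / (real m + 1)" for m
  proof -
    let ?Y = "\<lambda>\<omega>. S \<omega> - Mart (Suc m) \<omega>"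
    have intY: "integrable M ?Y"
      using S_integrable integrable_Mart(1) by simp
    have "(\<integral>\<omega>. ?Y \<omega> \<partial>M) = (\<integral>\<omega>. S \<omega> \<partial>M)"
      using S_integrable integrable_Mart(1) integral_innov_sum[of mcoef 0 "Suc m", folded Mart_def]
      by simp
    \<comment> \<open>The variance of \<open>?Y\<close> is nonnegative; its mean does not depend on
      \<open>m\<close>, whereas its second moment tends to zero.\<close>
    moreover have "(\<integral>\<omega>. ?Y \<omega> \<partial>M)\<^sup>2 \<le> (\<integral>\<omega>. (?Y \<omega>)\<^sup>2 \<partial>M)"
      using variance_eq[OF intY S_Mart_diff_sq(1)] variance_positive[of ?Y] by simp
    ultimately show ?thesis
      using S_Mart_diff_sq(2)[of "Suc m"] by (simp add: add.commute)
  qed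
  have "(\<lambda>m. 1 / (real m + 1)) \<longlonglongrightarrow> 0"
    by real_asymp
  then have "(\<integral>\<omega>. S \<omega> \<partial>M)\<^sup>2 \<le> 0"
    by (rule LIMSEQ_le_const) (use le in auto)
  then show ?thesis by simp
qed

lemma integral_Mart_sq_tendsto: "(\<lambda>m. \<integral>\<omega>. (Mart m \<omega>)\<^sup>2 \<partial>M) \<longlonglongrightarrow> (\<integral>\<omega>. (S \<omega>)\<^sup>2 \<partial>M)"
proof -
  define V where "V = (\<integral>\<omega>. (S \<omega>)\<^sup>2 \<partial>M)"
  have bound: "\<bar>(\<integral>\<omega>. (Mart m \<omega>)\<^sup>2 \<partial>M) - V\<bar> \<le> 1 / real m + (V + 1) / sqrt (real m)" if "m \<ge> 1" for m
  proof -
    \<comment> \<open>The weight for the cross term: it balances \<open>t\<close> times the second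
      moment of \<open>?Y\<close>, at most \<open>1 / t\<close>, against
      \<open>V / t\<close>.\<close>
    define t where "t = sqrt (real m)"
    have t: "0 < t" "t\<^sup>2 = real m"
      using that by (auto simp: t_def)
    let ?Y = "\<lambda>\<omega>. S \<omega> - Mart m \<omega>"
    have intY: "integrable M (\<lambda>\<omega>. (?Y \<omega>)\<^sup>2)" and Y: "(\<integral>\<omega>. (?Y \<omega>)\<^sup>2 \<partial>M) \<le> 1 / real m"
      using S_Mart_diff_sq[OF that] by auto
    have point: "\<bar>(Mart m \<omega>)\<^sup>2 - (S \<omega>)\<^sup>2\<bar> \<le> (1 + t) * (?Y \<omega>)\<^sup>2 + (1 / t) * (S \<omega>)\<^sup>2" for \<omega>
    proof -
      define x y where "x = \<bar>S \<omega>\<bar> / sqrt t" and "y = \<bar>?Y \<omega>\<bar> * sqrt t"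
      have xy: "x * y = \<bar>S \<omega>\<bar> * \<bar>?Y \<omega>\<bar>" "x\<^sup>2 = (1 / t) * (S \<omega>)\<^sup>2" "y\<^sup>2 = t * (?Y \<omega>)\<^sup>2"
        using t by (auto simp: x_def y_def power_divide power_mult_distrib)
      have "0 \<le> (x - y)\<^sup>2" by simp
      then have amgm: "2 * \<bar>S \<omega> * ?Y \<omega>\<bar> \<le> (1 / t) * (S \<omega>)\<^sup>2 + t * (?Y \<omega>)\<^sup>2"
        using xy by (simp add: power2_diff abs_mult)
      have "(Mart m \<omega>)\<^sup>2 - (S \<omega>)\<^sup>2 = (?Y \<omega>)\<^sup>2 - 2 * (S \<omega> * ?Y \<omega>)"
        by (simp add: power2_eq_square algebra_simps)
      moreover have "0 \<le> (?Y \<omega>)\<^sup>2" by simp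
      moreover have "(1 + t) * (?Y \<omega>)\<^sup>2 = (?Y \<omega>)\<^sup>2 + t * (?Y \<omega>)\<^sup>2"
        by (simp add: distrib_right)
      ultimately show ?thesis
        using amgm by linarith
    qed
    have "\<bar>(\<integral>\<omega>. (Mart m \<omega>)\<^sup>2 \<partial>M) - V\<bar> = \<bar>\<integral>\<omega>. (Mart m \<omega>)\<^sup>2 - (S \<omega>)\<^sup>2 \<partial>M\<bar>"
      using integrable_Mart(2) S_square_integrable by (simp add: V_def)
    also have "\<dots> \<le> (\<integral>\<omega>. \<bar>(Mart m \<omega>)\<^sup>2 - (S \<omega>)\<^sup>2\<bar> \<partial>M)"
      by (rule integral_abs_bound)
    also have "\<dots> \<le> (\<integral>\<omega>. (1 + t) * (?Y \<omega>)\<^sup>2 + (1 / t) * (S \<omega>)\<^sup>2 \<partial>M)"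
      using integrable_Mart(2) S_square_integrable intY point
      by (intro integral_mono) auto
    also have "\<dots> = (1 + t) * (\<integral>\<omega>. (?Y \<omega>)\<^sup>2 \<partial>M) + (1 / t) * V"
      using S_square_integrable intY by (simp add: V_def)
    also have "\<dots> \<le> (1 + t) * (1 / real m) + (1 / t) * V"
      using Y t by (intro add_right_mono mult_left_mono) auto
    also have "\<dots> = 1 / real m + (V + 1) / t"
      unfolding t(2)[symmetric] using t(1) by (simp add: field_simps power2_eq_square)
    finally show ?thesis by (simp add: t_def)
  qed
  have "(\<lambda>m. 1 / real m + (V + 1) / sqrt (real m)) \<longlonglongrightarrow> 0"
    by real_asymp
  then have "(\<lambda>m. (\<integral>\<omega>. (Mart m \<omega>)\<^sup>2 \<partial>M) - V) \<longlonglongrightarrow> 0"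
    by (rule Lim_null_comparison[rotated]) (use bound in \<open>auto simp: eventually_sequentially intro!: exI[of _ 1]\<close>)
  then show ?thesis
    by (simp add: V_def LIM_zero_cancel)
qed

lemma second_moment_S_sums: "(\<lambda>k. s2 k * hyp_excess q k) sums (\<integral>\<omega>. (S \<omega>)\<^sup>2 \<partial>M)"
proof -
  have "(\<lambda>n. (H n)\<^sup>2 * s2 n) \<longlonglongrightarrow> 0"
  proof (rule tendsto_0_le[OF s2_tendsto_zero, of _ 1])
    have "(H n)\<^sup>2 \<le> 1" for n
      using H_nonneg H_le_1 by (simp add: power_le_one)
    then show "\<forall>\<^sub>F n in sequentially. norm ((H n)\<^sup>2 * s2 n) \<le> norm (s2 n) * 1"
      using s2_nonneg by (intro always_eventually allI) (simp add: abs_mult mult_left_le_one_le)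
  qed
  from tendsto_diff[OF integral_Mart_sq_tendsto this] show ?thesis
    by (simp add: integral_Mart_sq sums_def)
qed

section \<open>The martingale part of the signed location\<close>

definition Xi :: "nat \<Rightarrow> 'a \<Rightarrow> real" where
  "Xi n \<omega> = (\<Sum>k=0..<n. (-1) ^ k * innov k \<omega>)"

lemma Xi_measurable_F: "Xi n \<in> borel_measurable (F n)"
  unfolding Xi_def[abs_def] by (rule innov_sum_measurable_F) simp

lemma integrable_Xi: "integrable M (Xi n)"
  unfolding Xi_def[abs_def] by (rule integrable_bounded[OF _ abs_innov_sum_le]) measurable

lemma martingale_Xi: "is_martingale M F Xi"
  unfolding is_martingale_def
proof (intro allI conjI ballI)
  fix n A assume A: "A \<in> sets (F n)"
  have [measurable]: "A \<in> sets M" using A by (rule F_sets_M)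
  have ind: "indicator A \<in> borel_measurable (F n)"
    using A by (rule borel_measurable_indicator)
  have "integrable M (\<lambda>\<omega>. indicator A \<omega> * Xi n \<omega>)"
    using integrable_mult_indicator[OF \<open>A \<in> sets M\<close> integrable_Xi[of n]] by simp
  moreover have "integrable M (\<lambda>\<omega>. indicator A \<omega> * innov n \<omega>)"
    using integrable_mult_indicator[OF \<open>A \<in> sets M\<close> integrable_bounded[OF innov_measurable abs_innov_le], of n] by simp
  moreover have "(\<integral>\<omega>. indicator A \<omega> * innov n \<omega> \<partial>M) = 0"
    by (rule integral_mult_innov[OF ind, of 1]) (simp add: indicator_def)
  ultimately have "(\<integral>\<omega>. indicator A \<omega> * Xi n \<omega> + (-1) ^ n * (indicator A \<omega> * innov n \<omega>) \<partial>M)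
      = (\<integral>\<omega>. indicator A \<omega> * Xi n \<omega> \<partial>M)"
    by simp
  then show "(LINT \<omega>:A|M. Xi (Suc n) \<omega>) = (LINT \<omega>:A|M. Xi n \<omega>)"
    by (simp add: set_lebesgue_integral_def Xi_def algebra_simps)
qed (rule integrable_Xi Xi_measurable_F)+

lemma integral_Xi: "(\<integral>\<omega>. Xi n \<omega> \<partial>M) = 0"
  unfolding Xi_def by (rule integral_innov_sum)

lemma abs_Xi_diff_le: "\<bar>Xi (Suc n) \<omega> - Xi n \<omega>\<bar> \<le> 2"
  using abs_innov_le[of n \<omega>] by (simp add: Xi_def abs_mult power_abs)

lemma Delta_s_eq: "Delta_s g n \<omega> = Xi n \<omega> + q * (\<Sum>k<n. (-1) ^ k * mean_step k \<omega>)"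
proof -
  have "Xi n \<omega> + q * (\<Sum>k<n. (-1) ^ k * mean_step k \<omega>) = (\<Sum>k<n. (-1) ^ k * (innov k \<omega> + q * mean_step k \<omega>))"
    by (simp add: Xi_def atLeast0LessThan sum_distrib_left sum.distrib[symmetric] algebra_simps)
  then show ?thesis
    by (simp add: Delta_s_eq_sum innov_def)
qed

text \<open>The alternating signs disappear on squaring, so only the conditional variances of the
  innovations remain. Countably many null sets are merged before summation.\<close>

lemma pred_qv_Xi_eq: "AE \<omega> in M. \<forall>n. pred_qv M F Xi n \<omega> = real n - q\<^sup>2 * (\<Sum>k<n. (mean_step k \<omega>)\<^sup>2)"
proof -
  have "AE \<omega> in M. real_cond_exp M (F k) (\<lambda>x. (Xi (Suc k) x - Xi k x)\<^sup>2) \<omega> = 1 - q\<^sup>2 * (mean_step k \<omega>)\<^sup>2" for k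
  proof -
    interpret S: finite_measure_subalgebra M "F k"
      by unfold_locales (rule subalg_F)
    have "(\<lambda>x. (Xi (Suc k) x - Xi k x)\<^sup>2) = (\<lambda>x. (innov k x)\<^sup>2)"
      by (simp add: Xi_def power_mult_distrib flip: power_mult)
    moreover have "AE \<omega> in M. real_cond_exp M (F k) (\<lambda>x. (innov k x)\<^sup>2) \<omega> = 1 - q\<^sup>2 * (mean_step k \<omega>)\<^sup>2"
    proof (rule S.real_cond_exp_charact)
      fix A assume A: "A \<in> sets (F k)"
      have ind: "indicator A \<in> borel_measurable (F k)"
        using A by (rule borel_measurable_indicator)
      have "\<bar>indicator A \<omega> :: real\<bar> \<le> 1" for \<omega> :: 'a
        by (simp add: indicator_def)
      from integral_mult_innov_sq[OF ind this]
      show "(LINT x:A|M. (innov k x)\<^sup>2) = (LINT x:A|M. 1 - q\<^sup>2 * (mean_step k x)\<^sup>2)"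
        by (simp add: set_lebesgue_integral_def)
    next
      show "integrable M (\<lambda>x. 1 - q\<^sup>2 * (mean_step k x)\<^sup>2)"
        by (intro Bochner_Integration.integrable_diff Bochner_Integration.integrable_mult_right integrable_mean_step_sq) simp
      show "(\<lambda>x. 1 - q\<^sup>2 * (mean_step k x)\<^sup>2) \<in> borel_measurable (F k)"
        by (intro borel_measurable_diff borel_measurable_times borel_measurable_power borel_measurable_const mean_step_measurable_F) simp
    qed (rule integrable_innov_sq)
    ultimately show ?thesis by simp
  qed
  then have "AE \<omega> in M. \<forall>k. real_cond_exp M (F k) (\<lambda>x. (Xi (Suc k) x - Xi k x)\<^sup>2) \<omega> = 1 - q\<^sup>2 * (mean_step k \<omega>)\<^sup>2"
    by (subst AE_all_countable) simp
  then show ?thesis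
  proof eventually_elim
    case (elim \<omega>)
    show ?case
    proof
      fix n
      have "pred_qv M F Xi n \<omega> = (\<Sum>k<n. real_cond_exp M (F k) (\<lambda>x. (Xi (Suc k) x - Xi k x)\<^sup>2) \<omega>)"
        unfolding pred_qv_def
        by (rule sum.reindex_bij_witness[of _ Suc "\<lambda>k. k - 1"]) auto
      also have "\<dots> = (\<Sum>k<n. 1 - q\<^sup>2 * (mean_step k \<omega>)\<^sup>2)"
        using elim by simp
      finally show "pred_qv M F Xi n \<omega> = real n - q\<^sup>2 * (\<Sum>k<n. (mean_step k \<omega>)\<^sup>2)"
        by (simp add: sum_subtractf sum_distrib_left)
    qed
  qed
qed

lemma pred_qv_Xi_tendsto: "AE \<omega> in M. (\<lambda>n. pred_qv M F Xi n \<omega> / real n) \<longlonglongrightarrow> 1"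
  using pred_qv_Xi_eq mean_step_tendsto_zero
proof eventually_elim
  case (elim \<omega>)
  have "(\<lambda>n. (mean_step n \<omega>)\<^sup>2) \<longlonglongrightarrow> 0"
    using elim(2) by (auto intro!: tendsto_eq_intros)
  then have "(\<lambda>n. 1 - q\<^sup>2 * ((\<Sum>k<n. (mean_step k \<omega>)\<^sup>2) / real n)) \<longlonglongrightarrow> 1 - q\<^sup>2 * 0"
    by (intro tendsto_intros tendsto_average_zero)
  then have "(\<lambda>n. 1 - q\<^sup>2 * ((\<Sum>k<n. (mean_step k \<omega>)\<^sup>2) / real n)) \<longlonglongrightarrow> 1"
    by simp
  moreover have "\<forall>\<^sub>F n in sequentially. 1 - q\<^sup>2 * ((\<Sum>k<n. (mean_step k \<omega>)\<^sup>2) / real n) = pred_qv M F Xi n \<omega> / real n"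
    using eventually_gt_at_top[of 0]
    by eventually_elim (simp add: elim(1) diff_divide_distrib)
  ultimately show ?case
    by (rule Lim_transform_eventually)
qed

text \<open>By \<open>Mart_eq\<close> the error is made up of \<open>S - Mart n\<close>, with second
  moment at most \<open>1 / n\<close>, and the boundary term, with second moment at most
  \<open>s2 n\<close>.\<close>

lemma partial_sum_L2_tendsto:
  "(\<lambda>n. \<integral>\<omega>. (q * (\<Sum>k<n. (-1) ^ k * mean_step k \<omega>) - q * S \<omega>)\<^sup>2 \<partial>M) \<longlonglongrightarrow> 0"
proof (rule Lim_null_comparison)
  have "norm (\<integral>\<omega>. (q * (\<Sum>k<n. (-1) ^ k * mean_step k \<omega>) - q * S \<omega>)\<^sup>2 \<partial>M) \<le> 2 * q\<^sup>2 * (1 / real n) + 2 * q\<^sup>2 * s2 n"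
    if "1 \<le> n" for n
  proof -
    have point: "(q * (\<Sum>k<n. (-1) ^ k * mean_step k \<omega>) - q * S \<omega>)\<^sup>2
        \<le> 2 * q\<^sup>2 * (S \<omega> - Mart n \<omega>)\<^sup>2 + 2 * q\<^sup>2 * (mean_step n \<omega>)\<^sup>2" for \<omega>
    proof -
      define x y where "x = S \<omega> - Mart n \<omega>" and "y = (-1) ^ n * H n * mean_step n \<omega>"
      have "(\<Sum>k<n. (-1) ^ k * mean_step k \<omega>) - S \<omega> = - (x + y)"
        by (simp add: x_def y_def Mart_eq)
      then have "(q * (\<Sum>k<n. (-1) ^ k * mean_step k \<omega>) - q * S \<omega>)\<^sup>2 = q\<^sup>2 * (x + y)\<^sup>2"
        by algebra
      also have "\<dots> \<le> q\<^sup>2 * (2 * x\<^sup>2 + 2 * (mean_step n \<omega>)\<^sup>2)"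
      proof (rule mult_left_mono)
        have "\<bar>y\<bar> \<le> \<bar>mean_step n \<omega>\<bar>"
          using H_nonneg[of n] H_le_1[of n] by (simp add: y_def abs_mult power_abs mult_left_le_one_le)
        then have "y\<^sup>2 \<le> (mean_step n \<omega>)\<^sup>2"
          by (simp add: abs_le_square_iff)
        moreover have "0 \<le> (x - y)\<^sup>2" by simp
        ultimately show "(x + y)\<^sup>2 \<le> 2 * x\<^sup>2 + 2 * (mean_step n \<omega>)\<^sup>2"
          unfolding power2_sum power2_diff by linarith
      qed simp
      finally show ?thesis
        by (simp add: x_def algebra_simps)
    qed
    have "norm (\<integral>\<omega>. (q * (\<Sum>k<n. (-1) ^ k * mean_step k \<omega>) - q * S \<omega>)\<^sup>2 \<partial>M)
        = (\<integral>\<omega>. (q * (\<Sum>k<n. (-1) ^ k * mean_step k \<omega>) - q * S \<omega>)\<^sup>2 \<partial>M)"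
      by simp
    also have "\<dots> \<le> (\<integral>\<omega>. 2 * q\<^sup>2 * (S \<omega> - Mart n \<omega>)\<^sup>2 + 2 * q\<^sup>2 * (mean_step n \<omega>)\<^sup>2 \<partial>M)"
      using S_Mart_diff_sq(1)[OF that] integrable_mean_step_sq[of n]
      by (intro integral_mono_AE' AE_I2 point) auto
    also have "\<dots> = 2 * q\<^sup>2 * (\<integral>\<omega>. (S \<omega> - Mart n \<omega>)\<^sup>2 \<partial>M) + 2 * q\<^sup>2 * s2 n"
      using S_Mart_diff_sq(1)[OF that] integrable_mean_step_sq[of n] by (simp add: s2_def)
    also have "\<dots> \<le> 2 * q\<^sup>2 * (1 / real n) + 2 * q\<^sup>2 * s2 n"
      using S_Mart_diff_sq(2)[OF that] by (intro add_right_mono mult_left_mono) auto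
    finally show ?thesis .
  qed
  then show "\<forall>\<^sub>F n in sequentially. norm (\<integral>\<omega>. (q * (\<Sum>k<n. (-1) ^ k * mean_step k \<omega>) - q * S \<omega>)\<^sup>2 \<partial>M)
      \<le> 2 * q\<^sup>2 * (1 / real n) + 2 * q\<^sup>2 * s2 n"
    by (auto simp: eventually_sequentially)
  show "(\<lambda>n. 2 * q\<^sup>2 * (1 / real n) + 2 * q\<^sup>2 * s2 n) \<longlonglongrightarrow> 0"
    using s2_tendsto_zero lim_1_over_n[where 'a = real] by (auto intro!: tendsto_eq_intros)
qed

section \<open>The second moment of the limit\<close>

text \<open>Inserting the integral for \<open>hyp_excess\<close> into
  \<open>second_moment_S_sums\<close> and exchanging sum and integral leaves the generating function
  \<open>K\<close> of \<open>k * s2 k\<close> at \<open>1 - u\<close>. The endpoints of the interval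
  form a null set.\<close>

lemma second_moment_S_integral:
  assumes K: "\<And>u. 0 < u \<Longrightarrow> u < 1 \<Longrightarrow> (\<lambda>k. real k * s2 k * (1 - u) ^ k) sums K u"
  shows "(\<integral>\<omega>. (S \<omega>)\<^sup>2 \<partial>M) = (LINT u:{0<..<1}|lborel. K u / (1 - u) * ((1 - u / 2) powr (q - 1) - 1))"
proof -
  define G where "G u = (1 - u / 2) powr (q - 1) - 1" for u :: real
  define f where "f k u = indicator {0<..<1} u *\<^sub>R (real k * s2 k * (1 - u) ^ (k - 1) * G u)" for k and u :: real
  have G_nonneg: "0 \<le> G u" if "0 < u" "u < 1" for u
    using powr_mono2'[of "q - 1" "1 - u / 2" 1] q_bounds that by (simp add: G_def)
  have f_nonneg: "0 \<le> f k u" for k u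
    using G_nonneg[of u] s2_nonneg[of k] by (auto simp: f_def indicator_def)
  have int: "integrable lborel (f k)" for k
  proof -
    have "set_integrable lborel {0<..<1} (\<lambda>u. s2 k * (real k * (1 - u) ^ (k - 1) * G u))"
      unfolding G_def
      by (intro set_integrable_mult_right set_integrable_subset[OF hyp_excess_integrable]) auto
    then show ?thesis
      by (simp add: set_integrable_def f_def[abs_def] mult_ac)
  qed
  have integral: "(\<integral>u. f k u \<partial>lborel) = s2 k * hyp_excess q k" for k
  proof -
    have "(\<integral>u. f k u \<partial>lborel) = (LINT u:{0<..<1}|lborel. s2 k * (real k * (1 - u) ^ (k - 1) * G u))"
      by (simp add: set_lebesgue_integral_def f_def mult_ac)
    also have "\<dots> = s2 k * (LINT u:{0<..<1}|lborel. real k * (1 - u) ^ (k - 1) * G u)"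
      by (rule set_integral_mult_right)
    also have "(LINT u:{0<..<1}|lborel. real k * (1 - u) ^ (k - 1) * G u) = hyp_excess q k"
      unfolding hyp_excess_def G_def
      by (rule set_integral_discrete_difference[where X = "{0, 1}"]) auto
    finally show ?thesis .
  qed
  have sums: "(\<lambda>k. f k u) sums (indicator {0<..<1} u *\<^sub>R (K u / (1 - u) * G u))" for u
  proof (cases "u \<in> {0<..<1}")
    case True
    then have u: "0 < u" "u < 1" by auto
    have "(\<lambda>k. real k * s2 k * (1 - u) ^ k / (1 - u) * G u) sums (K u / (1 - u) * G u)"
      by (intro sums_mult2 sums_divide K u)
    \<comment> \<open>For \<open>k = 0\<close> the truncated exponent \<open>k - 1\<close> is
      harmless, as the factor \<open>real k\<close> vanishes.\<close>
    moreover have "real k * s2 k * (1 - u) ^ k / (1 - u) = real k * s2 k * (1 - u) ^ (k - 1)" for k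
      using u by (cases k) auto
    ultimately show ?thesis
      using True by (simp add: f_def)
  qed (simp add: f_def)
  have "(\<lambda>k. \<integral>u. f k u \<partial>lborel) sums (\<integral>u. (\<Sum>k. f k u) \<partial>lborel)"
  proof (rule sums_integral[OF int])
    show "AE u in lborel. summable (\<lambda>k. norm (f k u))"
      using f_nonneg sums by (simp add: sums_summable[OF sums])
    \<comment> \<open>The terms are nonnegative, so absolute summability is the convergence already
      known from \<open>second_moment_S_sums\<close>.\<close>
    show "summable (\<lambda>k. \<integral>u. norm (f k u) \<partial>lborel)"
      using f_nonneg sums_summable[OF second_moment_S_sums] by (simp add: integral)
  qed
  then have "(\<lambda>k. s2 k * hyp_excess q k) sums (\<integral>u. indicator {0<..<1} u *\<^sub>R (K u / (1 - u) * G u) \<partial>lborel)"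
    unfolding integral sums_unique[OF sums, symmetric] .
  then show ?thesis
    using sums_unique2[OF second_moment_S_sums] by (simp add: set_lebesgue_integral_def G_def)
qed

text \<open>The rescaled quantity \<open>real n ^ 2 * s2 n\<close> is the second moment of
  \<open>W_erw g n\<close>; it meets the hypotheses of the closed forms.\<close>

lemma second_moment_recurrence:
  shows "real 1 ^ 2 * s2 1 = 1"
    and "n \<ge> 1 \<Longrightarrow> real (Suc n) ^ 2 * s2 (Suc n) = 1 + (1 + 2 * q / real n) * (real n ^ 2 * s2 n)"
proof -
  show "real 1 ^ 2 * s2 1 = 1"
    using s2_Suc[of 0] by (simp add: e2_eq)
  assume n: "n \<ge> 1"
  have "s2 (Suc n) = ((real n + q)\<^sup>2 * s2 n + (1 - q\<^sup>2 * s2 n)) / (real n + 1)\<^sup>2"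
    by (simp only: s2_Suc e2_eq power_divide times_divide_eq_left add_divide_distrib[of "(real n + q)\<^sup>2 * s2 n"])
  then have "real (Suc n) ^ 2 * s2 (Suc n) = (real n + q)\<^sup>2 * s2 n + (1 - q\<^sup>2 * s2 n)"
    by (simp add: add.commute)
  also have "\<dots> = 1 + (real n ^ 2 + 2 * q * real n) * s2 n"
    by (simp add: power2_eq_square algebra_simps)
  also have "real n ^ 2 + 2 * q * real n = (1 + 2 * q / real n) * real n ^ 2"
    using n by (simp add: field_simps power2_eq_square)
  finally show "real (Suc n) ^ 2 * s2 (Suc n) = 1 + (1 + 2 * q / real n) * (real n ^ 2 * s2 n)"
    by (simp only: mult.assoc)
qed

text \<open>At \<open>1 - u\<close> the negative binomial series sums to
  \<open>u powr (- 2 * q)\<close> and the geometric series to \<open>1 / u\<close>; their difference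
  over \<open>2 * q - 1\<close> is \<open>K u\<close>.\<close>

lemma second_moment_S_generic:
  assumes "q \<noteq> 1 / 2"
  shows "(\<integral>\<omega>. (S \<omega>)\<^sup>2 \<partial>M) = 1 / (2 * q - 1) * (LINT u:{0<..<1}|lborel.
      (u powr (- 2 * q + 1) - 1) / (1 - u) * (((1 - u / 2) powr (q - 1) - 1) / u))"
proof -
  have closed: "real k * s2 k = (pochhammer (2 * q) k / fact k - 1) / (2 * q - 1)" for k
    using second_moment_closed_form[of "\<lambda>n. real n ^ 2 * s2 n" q k] second_moment_recurrence assms
    by (cases "k = 0") (simp_all add: power2_eq_square)
  have K: "(\<lambda>k. real k * s2 k * (1 - u) ^ k) sums ((u powr (- 2 * q) - 1 / u) / (2 * q - 1))"
    if "0 < u" "u < 1" for u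
  proof -
    have "(\<lambda>k. pochhammer (2 * q) k / fact k * (1 - u) ^ k) sums (1 - (1 - u)) powr (- (2 * q))"
      using that by (intro pochhammer_series) auto
    moreover have "(\<lambda>k. (1 - u) ^ k) sums (1 / (1 - (1 - u)))"
      using that by (intro geometric_sums) auto
    ultimately have "(\<lambda>k. (pochhammer (2 * q) k / fact k * (1 - u) ^ k - (1 - u) ^ k) / (2 * q - 1)) sums
        (((1 - (1 - u)) powr (- (2 * q)) - 1 / (1 - (1 - u))) / (2 * q - 1))"
      by (intro sums_divide sums_diff)
    then show ?thesis
      by (simp add: closed left_diff_distrib)
  qed
  have "(\<integral>\<omega>. (S \<omega>)\<^sup>2 \<partial>M)
      = (LINT u:{0<..<1}|lborel. (u powr (- 2 * q) - 1 / u) / (2 * q - 1) / (1 - u) * ((1 - u / 2) powr (q - 1) - 1))"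
    by (rule second_moment_S_integral[OF K])
  also have "\<dots> = (LINT u:{0<..<1}|lborel. 1 / (2 * q - 1) *
      ((u powr (- 2 * q + 1) - 1) / (1 - u) * (((1 - u / 2) powr (q - 1) - 1) / u)))"
  proof (rule set_lebesgue_integral_cong)
    show "\<forall>u. u \<in> {0<..<1} \<longrightarrow> (u powr (- 2 * q) - 1 / u) / (2 * q - 1) / (1 - u) * ((1 - u / 2) powr (q - 1) - 1)
      = 1 / (2 * q - 1) * ((u powr (- 2 * q + 1) - 1) / (1 - u) * (((1 - u / 2) powr (q - 1) - 1) / u))"
    proof (intro allI impI)
      fix u :: real assume "u \<in> {0<..<1}"
      then have u: "0 < u" by simp
      then have "u powr (- 2 * q + 1) = u powr (- 2 * q) * u"
        by (subst powr_add) simp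
      with u have "u powr (- 2 * q) - 1 / u = (u powr (- 2 * q + 1) - 1) / u"
        by (simp add: diff_divide_distrib)
      then show "(u powr (- 2 * q) - 1 / u) / (2 * q - 1) / (1 - u) * ((1 - u / 2) powr (q - 1) - 1)
        = 1 / (2 * q - 1) * ((u powr (- 2 * q + 1) - 1) / (1 - u) * (((1 - u / 2) powr (q - 1) - 1) / u))"
        by (simp only:) (simp add: mult_ac)
    qed
  qed simp
  also have "\<dots> = 1 / (2 * q - 1) * (LINT u:{0<..<1}|lborel.
      (u powr (- 2 * q + 1) - 1) / (1 - u) * (((1 - u / 2) powr (q - 1) - 1) / u))"
    by (rule set_integral_mult_right)
  finally show ?thesis .
qed

text \<open>Here \<open>k * s2 k\<close> is a harmonic number, so \<open>harm_series\<close> at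
  \<open>1 - u\<close> gives \<open>K u = - ln u / u\<close>.\<close>

lemma second_moment_S_half:
  assumes "q = 1 / 2"
  shows "(\<integral>\<omega>. (S \<omega>)\<^sup>2 \<partial>M) = (LINT u:{0<..<1}|lborel.
      (- ln u) / (1 - u) * (((1 - u / 2) powr (- 1 / 2) - 1) / u))"
proof -
  have closed: "real k * s2 k = harm k" for k
    using second_moment_closed_form_half[of "\<lambda>n. real n ^ 2 * s2 n" k] second_moment_recurrence assms
    by (cases "k = 0") (simp_all add: power2_eq_square)
  have K: "(\<lambda>k. real k * s2 k * (1 - u) ^ k) sums (- ln u / u)" if "0 < u" "u < 1" for u
    using harm_series[of "1 - u"] that by (simp add: closed)
  have "(\<integral>\<omega>. (S \<omega>)\<^sup>2 \<partial>M)
      = (LINT u:{0<..<1}|lborel. - ln u / u / (1 - u) * ((1 - u / 2) powr (q - 1) - 1))"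
    by (rule second_moment_S_integral[OF K])
  also have "\<dots> = (LINT u:{0<..<1}|lborel. (- ln u) / (1 - u) * (((1 - u / 2) powr (- 1 / 2) - 1) / u))"
  proof -
    have q: "q - 1 = - 1 / 2" using assms by simp
    have "- ln u / u / (1 - u) * ((1 - u / 2) powr (q - 1) - 1)
        = (- ln u) / (1 - u) * (((1 - u / 2) powr (- 1 / 2) - 1) / u)" for u :: real
      unfolding q by (simp add: mult_ac)
    then show ?thesis by (simp only:)
  qed
  finally show ?thesis .
qed

end

theorem theorem2p2:
  fixes M :: "'a measure" and g :: "nat \<Rightarrow> 'a \<Rightarrow> bool" and p q :: real
  assumes P: "prob_space M"
    and p_range: "0 \<le> p" "p < 1"
    and q_def: "q = 2 * p - 1"
    and g_meas: "\<And>n. g n \<in> measurable M (count_space UNIV)"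
    and g_first: "measure M {\<omega> \<in> space M. g 1 \<omega>} = 1 / 2"
    and g_step: "\<And>n A. n \<ge> 1 \<Longrightarrow> A \<in> sets (erw_filt M g n) \<Longrightarrow>
        measure M (A \<inter> {\<omega> \<in> space M. g (Suc n) \<omega>}) =
        (LINT \<omega>:A|M. (p * A_cnt g n \<omega> + (1 - p) * B_cnt g n \<omega>) / real n)"
  shows "\<exists>\<Xi> :: nat \<Rightarrow> 'a \<Rightarrow> real.
     is_martingale M (erw_filt M g) \<Xi>
   \<and> (\<forall>n. (LINT \<omega>|M. \<Xi> n \<omega>) = 0)
   \<and> (\<exists>C. \<forall>n. \<forall>\<omega>\<in>space M. \<bar>\<Xi> (Suc n) \<omega> - \<Xi> n \<omega>\<bar> \<le> C)
   \<and> (AE \<omega> in M. (\<lambda>n. pred_qv M (erw_filt M g) \<Xi> n \<omega> / real n) \<longlonglongrightarrow> 1)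
   \<and> (\<forall>n. \<forall>\<omega>\<in>space M. Delta_s g n \<omega> =
          \<Xi> n \<omega> + q * (\<Sum>k\<in>{1..<n}. (-1) ^ k * W_erw g k \<omega> / real k))
   \<and> (let Z = (\<lambda>n \<omega>. Delta_s g n \<omega> - \<Xi> n \<omega>);
          Zinf = (\<lambda>\<omega>. q * (\<Sum>k. (-1) ^ k * W_erw g k \<omega> / real k))
      in (\<forall>n. Z (Suc n) \<in> borel_measurable (erw_filt M g n))
       \<and> (AE \<omega> in M. summable (\<lambda>k. (-1) ^ k * W_erw g k \<omega> / real k))
       \<and> (AE \<omega> in M. (\<lambda>n. Z n \<omega>) \<longlonglongrightarrow> Zinf \<omega>)
       \<and> Zinf \<in> borel_measurable M
       \<and> integrable M Zinf
       \<and> integrable M (\<lambda>\<omega>. (Zinf \<omega>)\<^sup>2)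
       \<and> (\<lambda>n. LINT \<omega>|M. (Z n \<omega> - Zinf \<omega>)\<^sup>2) \<longlonglongrightarrow> 0
       \<and> (LINT \<omega>|M. Zinf \<omega>) = 0
       \<and> (LINT \<omega>|M. (Zinf \<omega>)\<^sup>2) =
           (if q \<noteq> 1 / 2 then
              q\<^sup>2 / (2 * q - 1) *
              (LINT u:{0<..<1}|lborel.
                 (u powr (- 2 * q + 1) - 1) / (1 - u) * (((1 - u / 2) powr (q - 1) - 1) / u))
            else
              1 / 4 *
              (LINT u:{0<..<1}|lborel.
                 (- ln u) / (1 - u) * (((1 - u / 2) powr (- 1 / 2) - 1) / u))))"
proof -
  interpret prob_space M by (rule P)
  interpret elephant_walk M g p q
    by unfold_locales (fact p_range q_def g_meas g_first g_step)+
  have term_eq: "(-1) ^ k * W_erw g k \<omega> / real k = (-1) ^ k * mean_step k \<omega>" for k \<omega>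
    by (simp add: mean_step_def)
  \<comment> \<open>The term for \<open>k = 0\<close> is zero, so the sum from 1 in the statement
    agrees with the sum from 0 used in the locale.\<close>
  have drop0: "(\<Sum>k\<in>{1..<n}. (-1) ^ k * mean_step k \<omega>) = (\<Sum>k<n. (-1) ^ k * mean_step k \<omega>)" for n \<omega>
    by (rule sum.mono_neutral_left) (auto simp: not_less_eq_eq)
  have Z: "Delta_s g n \<omega> - Xi n \<omega> = q * (\<Sum>k<n. (-1) ^ k * mean_step k \<omega>)" for n \<omega>
    by (simp add: Delta_s_eq)
  \<comment> \<open>Predictability: the partial sum at time \<open>Suc n\<close> stops at
    \<open>mean_step n\<close>, which is known at time \<open>n\<close>.\<close>
  have Z_meas: "(\<lambda>\<omega>. q * (\<Sum>k<Suc n. (-1) ^ k * mean_step k \<omega>)) \<in> borel_measurable (F n)" for n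
    by (intro borel_measurable_times borel_measurable_sum borel_measurable_const mean_step_measurable_F) auto
  have summ: "AE \<omega> in M. summable (\<lambda>k. (-1) ^ k * mean_step k \<omega>)"
    using sums_S by eventually_elim (auto intro: sums_summable)
  have lim: "AE \<omega> in M. (\<lambda>n. q * (\<Sum>k<n. (-1) ^ k * mean_step k \<omega>)) \<longlonglongrightarrow> q * S \<omega>"
    using sums_S by eventually_elim (auto simp: sums_def intro!: tendsto_mult)
  have moment: "(LINT \<omega>|M. (q * S \<omega>)\<^sup>2) =
     (if q \<noteq> 1 / 2 then
        q\<^sup>2 / (2 * q - 1) *
        (LINT u:{0<..<1}|lborel.
           (u powr (- 2 * q + 1) - 1) / (1 - u) * (((1 - u / 2) powr (q - 1) - 1) / u))
      else
        1 / 4 *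
        (LINT u:{0<..<1}|lborel.
           (- ln u) / (1 - u) * (((1 - u / 2) powr (- 1 / 2) - 1) / u)))"
  proof -
    have sq: "(LINT \<omega>|M. (q * S \<omega>)\<^sup>2) = q\<^sup>2 * (LINT \<omega>|M. (S \<omega>)\<^sup>2)"
      by (simp add: power_mult_distrib)
    show ?thesis
    proof (cases "q = 1 / 2")
      case True
      then have "\<not> q \<noteq> 1 / 2" by simp
      have "q\<^sup>2 = 1 / 4"
        unfolding True by (simp add: power_divide)
      with sq show ?thesis
        unfolding if_not_P[OF \<open>\<not> q \<noteq> 1 / 2\<close>] second_moment_S_half[OF True] by (simp only:)
    next
      case False
      show ?thesis
        unfolding if_P[OF False] sq second_moment_S_generic[OF False] by simp
    qed
  qed
  have mean: "(LINT \<omega>|M. q * S \<omega>) = 0"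
    using integral_S by simp
  have meas: "(\<lambda>\<omega>. q * S \<omega>) \<in> borel_measurable M"
    by measurable
  have int: "integrable M (\<lambda>\<omega>. q * S \<omega>)" "integrable M (\<lambda>\<omega>. (q * S \<omega>)\<^sup>2)"
    using S_integrable S_square_integrable by (simp_all add: power_mult_distrib)
  show ?thesis
    unfolding Let_def term_eq drop0 S_def[symmetric]
    by (rule exI[of _ Xi], unfold Z, intro conjI allI ballI exI[of _ 2] martingale_Xi integral_Xi abs_Xi_diff_le pred_qv_Xi_tendsto Delta_s_eq
        Z_meas summ lim meas int partial_sum_L2_tendsto mean moment)
qed

end
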